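(* Let $p\in(0,1)$ be a constant. There exist an existential monadic second order sentence $\varphi_1$ using only 3 first order variables and an existential monadic second order sentence $\varphi_2$ using only 1 monadic variable such that, for both $j=1,2$, the probability ${\sf P}(G(n,p)\models\varphi_j)$ does not converge as $n\to\infty$.
   Context: $G(n,p)$ is the random graph on vertex set $\{1,\ldots,n\}$ in which each pair of vertices is joined by an edge independently with probability $p$. Sentences are about undirected graphs with relations $\sim$ (adjacency) and $=$. An existential monadic second order (EMSO) sentence is one of the form $\exists X_1\ldots\exists X_m\,\phi(X_1,\ldots,X_m)$, where the $X_i$ are monadic variables ranging over subsets of the vertex set and $\phi$ is a (finite) first order sentence in $\sim,=$ and the unary predicates $X_1,\ldots,X_m$; first order variables range over vertices. *)

theory Defs
  imports Complex_Main
begin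

text \<open>First order formulas over graphs: adjacency, equality, and unary predicates
  (monadic second order variables X_i, indexed by naturals). First order variables are
  indexed by naturals and may be re-used (requantified).\<close>

datatype fo =
    Adj nat nat
  | Eq nat nat
  | Mem nat nat          (* X_i(x_j) *)
  | Neg fo
  | Conj fo fo
  | Disj fo fo
  | Ex nat fo
  | All nat fo

fun fo_vars :: "fo \<Rightarrow> nat set" where
  "fo_vars (Adj i j) = {i, j}"
| "fo_vars (Eq i j) = {i, j}"
| "fo_vars (Mem k j) = {j}"
| "fo_vars (Neg f) = fo_vars f"
| "fo_vars (Conj f g) = fo_vars f \<union> fo_vars g"
| "fo_vars (Disj f g) = fo_vars f \<union> fo_vars g"
| "fo_vars (Ex x f) = insert x (fo_vars f)"
| "fo_vars (All x f) = insert x (fo_vars f)"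

fun fo_free :: "fo \<Rightarrow> nat set" where
  "fo_free (Adj i j) = {i, j}"
| "fo_free (Eq i j) = {i, j}"
| "fo_free (Mem k j) = {j}"
| "fo_free (Neg f) = fo_free f"
| "fo_free (Conj f g) = fo_free f \<union> fo_free g"
| "fo_free (Disj f g) = fo_free f \<union> fo_free g"
| "fo_free (Ex x f) = fo_free f - {x}"
| "fo_free (All x f) = fo_free f - {x}"

fun fo_preds :: "fo \<Rightarrow> nat set" where
  "fo_preds (Adj i j) = {}"
| "fo_preds (Eq i j) = {}"
| "fo_preds (Mem k j) = {k}"
| "fo_preds (Neg f) = fo_preds f"
| "fo_preds (Conj f g) = fo_preds f \<union> fo_preds g"
| "fo_preds (Disj f g) = fo_preds f \<union> fo_preds g"
| "fo_preds (Ex x f) = fo_preds f"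
| "fo_preds (All x f) = fo_preds f"

fun fo_sat :: "nat set \<Rightarrow> nat set set \<Rightarrow> (nat \<Rightarrow> nat set) \<Rightarrow> (nat \<Rightarrow> nat) \<Rightarrow> fo \<Rightarrow> bool" where
  "fo_sat V E S a (Adj i j) = ({a i, a j} \<in> E)"
| "fo_sat V E S a (Eq i j) = (a i = a j)"
| "fo_sat V E S a (Mem k j) = (a j \<in> S k)"
| "fo_sat V E S a (Neg f) = (\<not> fo_sat V E S a f)"
| "fo_sat V E S a (Conj f g) = (fo_sat V E S a f \<and> fo_sat V E S a g)"
| "fo_sat V E S a (Disj f g) = (fo_sat V E S a f \<or> fo_sat V E S a g)"
| "fo_sat V E S a (Ex x f) = (\<exists>v\<in>V. fo_sat V E S (a(x := v)) f)"
| "fo_sat V E S a (All x f) = (\<forall>v\<in>V. fo_sat V E S (a(x := v)) f)"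

text \<open>An EMSO sentence \<exists>X_0 ... \<exists>X_{m-1}. phi is represented by the pair (m, phi),
  where phi is a closed first order formula using only predicates X_0..X_{m-1}.\<close>
type_synonym emso = "nat \<times> fo"

definition emso_sentence :: "emso \<Rightarrow> bool" where
  "emso_sentence \<psi> \<longleftrightarrow> fo_free (snd \<psi>) = {} \<and> fo_preds (snd \<psi>) \<subseteq> {..<fst \<psi>}"

definition emso_num_fo_vars :: "emso \<Rightarrow> nat" where
  "emso_num_fo_vars \<psi> = card (fo_vars (snd \<psi>))"

definition emso_num_monadic :: "emso \<Rightarrow> nat" where
  "emso_num_monadic \<psi> = fst \<psi>"

definition emso_models :: "nat \<Rightarrow> nat set set \<Rightarrow> emso \<Rightarrow> bool" where
  "emso_models n E \<psi> \<longleftrightarrow>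
     (\<exists>S. (\<forall>i<fst \<psi>. S i \<subseteq> {1..n}) \<and> fo_sat {1..n} E S (\<lambda>_. 0) (snd \<psi>))"

definition all_pairs :: "nat \<Rightarrow> nat set set" where
  "all_pairs n = {{i, j} | i j. 1 \<le> i \<and> i < j \<and> j \<le> n}"

definition prob_Gnp :: "nat \<Rightarrow> real \<Rightarrow> emso \<Rightarrow> real" where
  "prob_Gnp n p \<psi> =
     (\<Sum>E\<in>Pow (all_pairs n).
        (if emso_models n E \<psi> then p ^ card E * (1 - p) ^ (card (all_pairs n) - card E) else 0))"

end

theory Submission
  imports Defs "HOL-Real_Asymp.Real_Asymp"
begin

text \<open>
  Call a tower a family of levels, each with elements of two kinds A and B, in which the bottom
  level has two elements of each kind and, on every further level, each kind is in bijection with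
  the pairs (A-element, B-element) of the level below, the bijection being given by adjacency. The
  kinds of level \<open>i\<close> have \<open>a = 2 ^ 2 ^ i\<close> elements. Levels are coloured mod 3 and the top level must
  have colour 0, so \<open>3 dvd i\<close>. No order is needed to exclude cyclic arrangements of levels,
  since sizes grow strictly. Two conditions tie \<open>a\<close> to \<open>n\<close>. A set C whose elements are determined
  by at most one neighbour in each kind of the top level separates all vertices, so \<open>n\<close> is at most
  about \<open>2 ^ (a + 1)\<^sup>2\<close>; and the B-elements of a level form a clique, so \<open>a = O(log n)\<close> with high
  probability. All this is expressible with three first order variables, and it fails with high
  probability for \<open>n = 2 ^ a ^ 4\<close>, because the next admissible size is \<open>a ^ 8\<close>.

  For the second sentence, the unary predicates are replaced by the neighbourhoods, inside one
  set, of a few vertices; it implies the first one. For \<open>n = 2 ^ b ^ 3\<close> with \<open>b\<^sup>2 = a\<close> it holds with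
  high probability: every adjacency pattern on every set of \<open>O(b\<^sup>2)\<close> vertices is realised, and
  for every pair of vertices a fixed fraction of the vertices realising it separates them. So the
  tower can be embedded vertex by vertex, and C chosen greedily.
\<close>

section \<open>The sentences\<close>

definition Imp :: "fo \<Rightarrow> fo \<Rightarrow> fo" where
  "Imp f g = Disj (Neg f) g"

definition Iff :: "fo \<Rightarrow> fo \<Rightarrow> fo" where
  "Iff f g = Conj (Imp f g) (Imp g f)"

lemma fo_sat_Imp [simp]: "fo_sat V E S a (Imp f g) = (fo_sat V E S a f \<longrightarrow> fo_sat V E S a g)"
  and fo_sat_Iff [simp]: "fo_sat V E S a (Iff f g) = (fo_sat V E S a f \<longleftrightarrow> fo_sat V E S a g)"
  by (auto simp: Imp_def Iff_def)

text \<open>The empty conjunction is a closed truth: \<open>Eq 0 0\<close> alone would leave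
  variable 0 free, and variable 0 is one of the three variables in use anyway.\<close>

fun Conjs :: "fo list \<Rightarrow> fo" where
  "Conjs [] = All 0 (Eq 0 0)"
| "Conjs (f # fs) = Conj f (Conjs fs)"

lemma fo_sat_Conjs [simp]: "fo_sat V E S a (Conjs fs) = (\<forall>f\<in>set fs. fo_sat V E S a f)"
  by (induction fs) auto

definition ElemF :: "nat \<Rightarrow> fo" where
  "ElemF x = Disj (Mem 0 x) (Mem 1 x)"

definition SameKindF :: "nat \<Rightarrow> nat \<Rightarrow> fo" where
  "SameKindF x y = Disj (Conj (Mem 0 x) (Mem 0 y)) (Conj (Mem 1 x) (Mem 1 y))"

text \<open>Adjacency is symmetric, so the colours orient it: from bottom (both marks) or colour 0
  (neither) to 1 (only 4), then to 2 (only 5), then to 0. The equivalence in the first case covers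
  both starting colours; the bottom colour succeeds nothing.\<close>

definition NextF :: "nat \<Rightarrow> nat \<Rightarrow> fo" where
  "NextF s t = Conjs [Mem 3 s, Mem 3 t, Adj s t,
     Disj (Conjs [Iff (Mem 4 s) (Mem 5 s), Mem 4 t, Neg (Mem 5 t)])
       (Disj (Conjs [Mem 4 s, Neg (Mem 5 s), Neg (Mem 4 t), Mem 5 t])
             (Conjs [Neg (Mem 4 s), Mem 5 s, Neg (Mem 4 t), Neg (Mem 5 t)]))]"

definition SameLevelF :: "nat \<Rightarrow> nat \<Rightarrow> nat \<Rightarrow> fo" where
  "SameLevelF x y z = Ex z (Conjs [Mem 3 z, Adj x z, Adj y z])"

text \<open>Once \<open>z\<close> holds the token of \<open>x\<close>, the inner quantifier rebinds
  \<open>x\<close> to the token of the level below, so a single spare variable suffices for both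
  tokens.\<close>

definition PrevLevelF :: "nat \<Rightarrow> nat \<Rightarrow> nat \<Rightarrow> fo" where
  "PrevLevelF x y z = Ex z (Conj (Adj x z) (Ex x (Conj (NextF x z) (Adj x y))))"

definition ParentF :: "nat \<Rightarrow> nat \<Rightarrow> nat \<Rightarrow> fo" where
  "ParentF x y z = Conj (PrevLevelF x y z) (Adj x y)"

definition BottomF :: "nat \<Rightarrow> nat \<Rightarrow> fo" where
  "BottomF x y = Ex y (Conjs [Mem 3 y, Mem 4 y, Mem 5 y, Adj x y])"

definition TopF :: "nat \<Rightarrow> nat \<Rightarrow> fo" where
  "TopF x y = Ex y (Conj (Mem 12 y) (Adj x y))"

definition HasNextF :: "nat \<Rightarrow> nat \<Rightarrow> nat \<Rightarrow> fo" where
  "HasNextF x y z = Ex z (Conj (Adj x z) (Ex y (NextF z y)))"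

definition DiffF :: "nat \<Rightarrow> nat \<Rightarrow> nat \<Rightarrow> fo" where
  "DiffF x y z = Neg (Iff (Adj z x) (Adj z y))"

definition SameBitsF :: "nat \<Rightarrow> nat \<Rightarrow> fo" where
  "SameBitsF x y = Conjs (map (\<lambda>k. Iff (Mem k x) (Mem k y)) [0..<13])"

text \<open>
  Roles of the predicates: 0 and 1 are the two kinds of elements, 2 the separating set, 3 the
  tokens, each of which represents a level (its elements are adjacent to it). Predicates 4 and 5
  give the colour of a token: both on the bottom level, otherwise 4, 5, neither according to the
  level mod 3; on elements, 4 is a mark needed to say ``exactly two'' with three variables.
  Predicates 6 to 11 only serve to tell vertices apart; 12 marks the top token.

  In the formulas with a spare variable the variables are requantified, which keeps their total
  number at three.
\<close>

definition tower_fo :: fo where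
  "tower_fo = Conjs [
    All 0 (All 1 (All 2 (Imp (Conjs [ElemF 0, Mem 3 1, Mem 3 2, Adj 0 1, Adj 0 2]) (Eq 1 2)))),
    All 0 (All 1 (All 2 (Imp (Conj (NextF 0 1) (NextF 0 2)) (Eq 1 2)))),
    All 0 (All 1 (All 2 (Imp (Conj (NextF 1 0) (NextF 2 0)) (Eq 1 2)))),
    All 0 (Imp (Mem 3 0) (Conjs [
      Ex 1 (Conjs [Mem 0 1, Mem 4 1, Adj 1 0]), Ex 1 (Conjs [Mem 0 1, Neg (Mem 4 1), Adj 1 0]),
      Ex 1 (Conjs [Mem 1 1, Mem 4 1, Adj 1 0]), Ex 1 (Conjs [Mem 1 1, Neg (Mem 4 1), Adj 1 0])])),
    All 0 (Imp (Mem 3 0) (Disj (Conj (Mem 4 0) (Mem 5 0)) (Ex 1 (NextF 1 0)))),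
    All 0 (All 1 (Imp (Conjs [SameKindF 0 1, Iff (Mem 4 0) (Mem 4 1), BottomF 0 2, SameLevelF 0 1 2]) (Eq 0 1))),
    All 0 (Imp (ElemF 0) (Disj (BottomF 0 1)
      (Conj (Ex 1 (Conj (Mem 0 1) (ParentF 0 1 2))) (Ex 1 (Conj (Mem 1 1) (ParentF 0 1 2)))))),
    All 0 (All 1 (All 2 (Imp (Conjs [ElemF 0, SameKindF 1 2, ParentF 0 1 2, ParentF 0 2 1]) (Eq 1 2)))),
    All 0 (All 1 (Imp (Conjs [SameKindF 0 1, SameLevelF 0 1 2, Neg (BottomF 0 2), Neg (Eq 0 1)])
      (Ex 2 (Conjs [ElemF 2, PrevLevelF 0 2 1, DiffF 0 1 2])))),
    All 0 (All 1 (Imp (Conjs [Mem 0 0, Mem 1 1, SameLevelF 0 1 2, HasNextF 0 1 2])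
      (Conj (Ex 2 (Conjs [Mem 0 2, ParentF 2 0 1, ParentF 2 1 0]))
            (Ex 2 (Conjs [Mem 1 2, ParentF 2 0 1, ParentF 2 1 0]))))),
    All 0 (All 1 (Imp (Conjs [Mem 1 0, Mem 1 1, SameLevelF 0 1 2, Neg (Eq 0 1)]) (Adj 0 1))),
    All 0 (All 1 (All 2 (Imp (Conjs [Mem 2 0, SameKindF 1 2, TopF 1 0, TopF 2 0, Adj 0 1, Adj 0 2]) (Eq 1 2)))),
    All 0 (All 1 (Imp (Conjs [Mem 2 0, Mem 2 1, Neg (Eq 0 1)])
      (Ex 2 (Conjs [ElemF 2, TopF 2 0, DiffF 0 1 2])))),
    All 0 (All 1 (Imp (Conj (SameBitsF 0 1) (Neg (Eq 0 1))) (Ex 2 (Conj (Mem 2 2) (DiffF 0 1 2))))),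
    Ex 0 (Conjs [Mem 12 0, Mem 3 0, Neg (Mem 4 0), Neg (Mem 5 0)]),
    All 0 (All 1 (Imp (Conj (Mem 12 0) (Mem 12 1)) (Eq 0 1)))]"

lemmas formula_defs = ElemF_def SameKindF_def NextF_def SameLevelF_def PrevLevelF_def ParentF_def
  BottomF_def TopF_def HasNextF_def DiffF_def SameBitsF_def

section \<open>Semantic counterparts of the formulas\<close>

locale coloured_graph =
  fixes V :: "nat set" and E :: "nat set set" and S :: "nat \<Rightarrow> nat set"
begin

definition adj :: "nat \<Rightarrow> nat \<Rightarrow> bool" where
  "adj x y \<longleftrightarrow> {x, y} \<in> E"

lemma adj_commute: "adj x y \<longleftrightarrow> adj y x"
  by (simp add: adj_def insert_commute)

definition elem :: "nat \<Rightarrow> bool" where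
  "elem x \<longleftrightarrow> x \<in> S 0 \<or> x \<in> S 1"

definition same_kind :: "nat \<Rightarrow> nat \<Rightarrow> bool" where
  "same_kind x y \<longleftrightarrow> x \<in> S 0 \<and> y \<in> S 0 \<or> x \<in> S 1 \<and> y \<in> S 1"

definition "next" :: "nat \<Rightarrow> nat \<Rightarrow> bool" where
  "next s t \<longleftrightarrow> s \<in> S 3 \<and> t \<in> S 3 \<and> adj s t \<and>
     ((s \<in> S 4 \<longleftrightarrow> s \<in> S 5) \<and> t \<in> S 4 \<and> t \<notin> S 5 \<or>
      s \<in> S 4 \<and> s \<notin> S 5 \<and> t \<notin> S 4 \<and> t \<in> S 5 \<or>
      s \<notin> S 4 \<and> s \<in> S 5 \<and> t \<notin> S 4 \<and> t \<notin> S 5)"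

definition same_level :: "nat \<Rightarrow> nat \<Rightarrow> bool" where
  "same_level x y \<longleftrightarrow> (\<exists>t\<in>V. t \<in> S 3 \<and> adj x t \<and> adj y t)"

definition prev_level :: "nat \<Rightarrow> nat \<Rightarrow> bool" where
  "prev_level x y \<longleftrightarrow> (\<exists>t\<in>V. adj x t \<and> (\<exists>s\<in>V. next s t \<and> adj s y))"

definition parent :: "nat \<Rightarrow> nat \<Rightarrow> bool" where
  "parent x y \<longleftrightarrow> prev_level x y \<and> adj x y"

definition bottom :: "nat \<Rightarrow> bool" where
  "bottom x \<longleftrightarrow> (\<exists>t\<in>V. t \<in> S 3 \<and> t \<in> S 4 \<and> t \<in> S 5 \<and> adj x t)"

definition top :: "nat \<Rightarrow> bool" where
  "top x \<longleftrightarrow> (\<exists>t\<in>V. t \<in> S 12 \<and> adj x t)"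

definition has_next :: "nat \<Rightarrow> bool" where
  "has_next x \<longleftrightarrow> (\<exists>s\<in>V. adj x s \<and> (\<exists>t\<in>V. next s t))"

definition splits :: "nat \<Rightarrow> nat \<Rightarrow> nat \<Rightarrow> bool" where
  "splits z x y \<longleftrightarrow> (adj z x \<longleftrightarrow> \<not> adj z y)"

definition same_bits :: "nat \<Rightarrow> nat \<Rightarrow> bool" where
  "same_bits x y \<longleftrightarrow> (\<forall>k<13. x \<in> S k \<longleftrightarrow> y \<in> S k)"

end

text \<open>One assumption per conjunct of \<open>tower_fo\<close>, in the same order. The first
  three make levels disjoint and the successor relation injective and functional.
  \<open>both_marks\<close> and \<open>bottom_unique\<close> fix the bottom sizes;
  \<open>parents\<close> to \<open>child_exists\<close> give the bijections with pairs.
  \<open>level_clique\<close> ties the top size to the clique number, and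
  \<open>top_nbr_unique\<close> to \<open>split_by_C\<close> bound the number of vertices by
  it.\<close>

locale tower = coloured_graph +
  assumes token_unique: "\<lbrakk>x \<in> V; t \<in> V; t' \<in> V; elem x; t \<in> S 3; t' \<in> S 3; adj x t; adj x t'\<rbrakk> \<Longrightarrow> t = t'"
    and next_unique: "\<lbrakk>s \<in> V; t \<in> V; t' \<in> V; next s t; next s t'\<rbrakk> \<Longrightarrow> t = t'"
    and prev_unique: "\<lbrakk>s \<in> V; s' \<in> V; t \<in> V; next s t; next s' t\<rbrakk> \<Longrightarrow> s = s'"
    and both_marks: "\<lbrakk>t \<in> V; t \<in> S 3\<rbrakk> \<Longrightarrow>
      (\<exists>x\<in>V. x \<in> S 0 \<and> x \<in> S 4 \<and> adj x t) \<and> (\<exists>x\<in>V. x \<in> S 0 \<and> x \<notin> S 4 \<and> adj x t) \<and>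
      (\<exists>x\<in>V. x \<in> S 1 \<and> x \<in> S 4 \<and> adj x t) \<and> (\<exists>x\<in>V. x \<in> S 1 \<and> x \<notin> S 4 \<and> adj x t)"
    and bottom_or_prev: "\<lbrakk>t \<in> V; t \<in> S 3\<rbrakk> \<Longrightarrow> t \<in> S 4 \<and> t \<in> S 5 \<or> (\<exists>s\<in>V. next s t)"
    and bottom_unique: "\<lbrakk>x \<in> V; y \<in> V; same_kind x y; x \<in> S 4 \<longleftrightarrow> y \<in> S 4; bottom x; same_level x y\<rbrakk> \<Longrightarrow> x = y"
    and parents: "\<lbrakk>x \<in> V; elem x\<rbrakk> \<Longrightarrow> bottom x \<or> (\<exists>y\<in>V. y \<in> S 0 \<and> parent x y) \<and> (\<exists>y\<in>V. y \<in> S 1 \<and> parent x y)"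
    and parent_unique: "\<lbrakk>x \<in> V; y \<in> V; z \<in> V; elem x; same_kind y z; parent x y; parent x z\<rbrakk> \<Longrightarrow> y = z"
    and split_by_prev: "\<lbrakk>x \<in> V; y \<in> V; same_kind x y; same_level x y; \<not> bottom x; x \<noteq> y\<rbrakk> \<Longrightarrow>
      \<exists>z\<in>V. elem z \<and> prev_level x z \<and> splits z x y"
    and child_exists: "\<lbrakk>x \<in> V; y \<in> V; x \<in> S 0; y \<in> S 1; same_level x y; has_next x\<rbrakk> \<Longrightarrow>
      (\<exists>z\<in>V. z \<in> S 0 \<and> parent z x \<and> parent z y) \<and> (\<exists>z\<in>V. z \<in> S 1 \<and> parent z x \<and> parent z y)"
    and level_clique: "\<lbrakk>x \<in> V; y \<in> V; x \<in> S 1; y \<in> S 1; same_level x y; x \<noteq> y\<rbrakk> \<Longrightarrow> adj x y"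
    and top_nbr_unique: "\<lbrakk>c \<in> V; y \<in> V; z \<in> V; c \<in> S 2; same_kind y z; top y; top z; adj c y; adj c z\<rbrakk> \<Longrightarrow> y = z"
    and split_by_top: "\<lbrakk>x \<in> V; y \<in> V; x \<in> S 2; y \<in> S 2; x \<noteq> y\<rbrakk> \<Longrightarrow> \<exists>z\<in>V. elem z \<and> top z \<and> splits z x y"
    and split_by_C: "\<lbrakk>x \<in> V; y \<in> V; same_bits x y; x \<noteq> y\<rbrakk> \<Longrightarrow> \<exists>z\<in>V. z \<in> S 2 \<and> splits z x y"
    and top_exists: "\<exists>t\<in>V. t \<in> S 12 \<and> t \<in> S 3 \<and> t \<notin> S 4 \<and> t \<notin> S 5"
    and top_unique: "\<lbrakk>t \<in> V; t' \<in> V; t \<in> S 12; t' \<in> S 12\<rbrakk> \<Longrightarrow> t = t'"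

lemma all_less_13: "(\<forall>k<13. Pr k) = (\<forall>k\<in>{0..<13::nat}. Pr k)"
  by auto

text \<open>The side conditions keep a requantified variable from capturing one whose value is still
  used.\<close>

lemma fo_sat_macros:
  fixes V E S
  defines "adj \<equiv> coloured_graph.adj E"
  shows "fo_sat V E S a (Adj i j) = adj (a i) (a j)"
    and "fo_sat V E S a (ElemF x) = coloured_graph.elem S (a x)"
    and "fo_sat V E S a (SameKindF x y) = coloured_graph.same_kind S (a x) (a y)"
    and "fo_sat V E S a (NextF x y) = coloured_graph.next E S (a x) (a y)"
    and "x \<noteq> z \<Longrightarrow> y \<noteq> z \<Longrightarrow> fo_sat V E S a (SameLevelF x y z) = coloured_graph.same_level V E S (a x) (a y)"
    and "x \<noteq> z \<Longrightarrow> x \<noteq> y \<Longrightarrow> y \<noteq> z \<Longrightarrow> fo_sat V E S a (PrevLevelF x y z) = coloured_graph.prev_level V E S (a x) (a y)"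
    and "x \<noteq> z \<Longrightarrow> x \<noteq> y \<Longrightarrow> y \<noteq> z \<Longrightarrow> fo_sat V E S a (ParentF x y z) = coloured_graph.parent V E S (a x) (a y)"
    and "x \<noteq> y \<Longrightarrow> fo_sat V E S a (BottomF x y) = coloured_graph.bottom V E S (a x)"
    and "x \<noteq> y \<Longrightarrow> fo_sat V E S a (TopF x y) = coloured_graph.top V E S (a x)"
    and "x \<noteq> z \<Longrightarrow> x \<noteq> y \<Longrightarrow> y \<noteq> z \<Longrightarrow> fo_sat V E S a (HasNextF x y z) = coloured_graph.has_next V E S (a x)"
    and "fo_sat V E S a (DiffF x y z) = coloured_graph.splits E (a z) (a x) (a y)"
    and "fo_sat V E S a (SameBitsF x y) = coloured_graph.same_bits S (a x) (a y)"
  by (auto simp: assms formula_defs coloured_graph.adj_def coloured_graph.elem_def coloured_graph.same_kind_def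
      coloured_graph.next_def coloured_graph.same_level_def coloured_graph.prev_level_def coloured_graph.parent_def
      coloured_graph.bottom_def coloured_graph.top_def coloured_graph.has_next_def coloured_graph.splits_def
      coloured_graph.same_bits_def all_less_13)

lemma fo_sat_tower_fo: "fo_sat V E S a tower_fo \<longleftrightarrow> tower V E S"
  unfolding tower_fo_def tower_def
  by (simp add: fo_sat_macros del: fo_sat.simps(1))
   (intro conj_cong refl; blast)

definition emso3 :: emso where
  "emso3 = (13, tower_fo)"

lemma tower_fo_syntax:
  "fo_free tower_fo = {}" "fo_preds tower_fo \<subseteq> {..<13}" "fo_vars tower_fo = {0, 1, 2}"
  by (auto simp: tower_fo_def formula_defs Imp_def Iff_def upt_rec)

lemma emso3_sentence: "emso_sentence emso3" "emso_num_fo_vars emso3 \<le> 3"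
  using tower_fo_syntax by (auto simp: emso3_def emso_sentence_def emso_num_fo_vars_def)

text \<open>
  Predicates 0 to 5 become traces on a single set of the neighbourhoods of six vertices, held by
  the variables 3 to 8. Predicates 6 to 11 become the singletons of these vertices, which the
  separating set cannot distinguish because all its elements are adjacent to the same ones.
\<close>

fun name_preds :: "fo \<Rightarrow> fo" where
  "name_preds (Adj i j) = Adj i j"
| "name_preds (Eq i j) = Eq i j"
| "name_preds (Mem k j) = (if k < 6 then Conj (Mem 0 j) (Adj j (3 + k)) else Eq j (k - 3))"
| "name_preds (Neg f) = Neg (name_preds f)"
| "name_preds (Conj f g) = Conj (name_preds f) (name_preds g)"
| "name_preds (Disj f g) = Disj (name_preds f) (name_preds g)"
| "name_preds (Ex x f) = Ex x (name_preds f)"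
| "name_preds (All x f) = All x (name_preds f)"

text \<open>Predicate 12, the top token, becomes the singleton of a seventh vertex
  \<open>u 6\<close>. Vertex \<open>u i\<close> is held by variable \<open>3 + i\<close>, which for
  \<open>i = k - 6\<close> is the variable \<open>k - 3\<close> of
  \<open>name_preds\<close>.\<close>

definition named_preds :: "nat set set \<Rightarrow> nat set \<Rightarrow> (nat \<Rightarrow> nat) \<Rightarrow> nat \<Rightarrow> nat set" where
  "named_preds E X u k = (if k < 6 then {x \<in> X. {x, u k} \<in> E} else {u (k - 6)})"

text \<open>As \<open>f\<close> only uses variables 0 to 2, its quantifiers never rebind the
  variables that hold the named vertices.\<close>

lemma fo_sat_name_preds:
  "fo_vars f \<subseteq> {..<3} \<Longrightarrow>
   fo_sat V E S a (name_preds f) = fo_sat V E (named_preds E (S 0) (\<lambda>k. a (3 + k))) a f"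
proof (induction f arbitrary: a)
  case (Mem k j)
  then show ?case
    by (auto simp: named_preds_def not_less)
qed (auto simp: named_preds_def)

lemma fo_preds_name_preds: "fo_preds (name_preds f) \<subseteq> {0}"
  by (induction f) auto

lemma fo_free_name_preds: "fo_preds f \<subseteq> {..<13} \<Longrightarrow> fo_free (name_preds f) \<subseteq> fo_free f \<union> {3..<10}"
  by (induction f) auto

lemma fo_free_foldr_Ex: "fo_free (foldr Ex xs f) = fo_free f - set xs"
  and fo_preds_foldr_Ex: "fo_preds (foldr Ex xs f) = fo_preds f"
  by (induction xs) auto

text \<open>The seven named vertices are quantified first order, at the price of seven more
  variables; the only monadic variable is the set in which the traces are taken.\<close>

definition emso1 :: emso where
  "emso1 = (1, foldr Ex [3..<10] (name_preds tower_fo))"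

lemma emso1_sentence: "emso_sentence emso1" "emso_num_monadic emso1 = 1"
proof -
  have "fo_free (name_preds tower_fo) \<subseteq> {3..<10}"
    using fo_free_name_preds[of tower_fo] tower_fo_syntax by auto
  then have "fo_free (snd emso1) = {}"
    unfolding emso1_def snd_conv fo_free_foldr_Ex set_upt by blast
  then show "emso_sentence emso1"
    unfolding emso_sentence_def using fo_preds_name_preds[of tower_fo]
    unfolding emso1_def fst_conv snd_conv fo_preds_foldr_Ex by auto
  show "emso_num_monadic emso1 = 1"
    unfolding emso1_def emso_num_monadic_def by (rule fst_conv)
qed

lemma fo_sat_foldr_Ex:
  "distinct xs \<Longrightarrow> fo_sat V E S a (foldr Ex xs f) \<longleftrightarrow>
     (\<exists>b. (\<forall>x\<in>set xs. b x \<in> V) \<and> (\<forall>x. x \<notin> set xs \<longrightarrow> b x = a x) \<and> fo_sat V E S b f)"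
proof (induction xs arbitrary: a)
  case Nil
  have "b = a" if "\<forall>x. b x = a x" for b :: "nat \<Rightarrow> nat"
    using that by auto
  then show ?case
    by auto
next
  case (Cons x xs)
  have "fo_sat V E S a (foldr Ex (x # xs) f) \<longleftrightarrow>
    (\<exists>v\<in>V. \<exists>b. (\<forall>y\<in>set xs. b y \<in> V) \<and> (\<forall>y. y \<notin> set xs \<longrightarrow> b y = (a(x := v)) y) \<and> fo_sat V E S b f)"
    using Cons by simp
  also have "\<dots> \<longleftrightarrow> (\<exists>b. (\<forall>y\<in>set (x # xs). b y \<in> V) \<and> (\<forall>y. y \<notin> set (x # xs) \<longrightarrow> b y = a y) \<and> fo_sat V E S b f)"
    (is "?L \<longleftrightarrow> ?R")
  proof
    assume ?L
    then obtain v b where "v \<in> V" "\<forall>y\<in>set xs. b y \<in> V" "\<forall>y. y \<notin> set xs \<longrightarrow> b y = (a(x := v)) y" "fo_sat V E S b f"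
      by blast
    then show ?R
      using Cons.prems by (intro exI[of _ b]) auto
  next
    assume ?R
    then obtain b where "\<forall>y\<in>set (x # xs). b y \<in> V" "\<forall>y. y \<notin> set (x # xs) \<longrightarrow> b y = a y" "fo_sat V E S b f"
      by blast
    then show ?L
      by (intro bexI[of _ "b x"] exI[of _ b]) auto
  qed
  finally show ?case .
qed

lemma fo_sat_cong_preds:
  "(\<And>k. k \<in> fo_preds f \<Longrightarrow> S k = S' k) \<Longrightarrow> fo_sat V E S a f = fo_sat V E S' a f"
  by (induction f arbitrary: a) auto

lemma emso3_models_iff:
  "emso_models n E emso3 \<longleftrightarrow> (\<exists>S. (\<forall>i<13. S i \<subseteq> {1..n}) \<and> tower {1..n} E S)"
  by (simp add: emso_models_def emso3_def fo_sat_tower_fo)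

lemma emso1_models_iff:
  "emso_models n E emso1 \<longleftrightarrow>
     (\<exists>X u. X \<subseteq> {1..n} \<and> (\<forall>k<7. u k \<in> {1..n}) \<and> tower {1..n} E (named_preds E X u))"
proof -
  have vars: "fo_vars tower_fo \<subseteq> {..<3}"
    by (simp add: tower_fo_syntax)
  have "emso_models n E emso1 \<longleftrightarrow> (\<exists>S :: nat \<Rightarrow> nat set. S 0 \<subseteq> {1..n} \<and>
     (\<exists>b. (\<forall>x\<in>{3..<10}. b x \<in> {1..n}) \<and> (\<forall>x. x \<notin> {3..<10} \<longrightarrow> b x = 0) \<and>
       tower {1..n} E (named_preds E (S 0) (\<lambda>k. b (3 + k)))))"
    unfolding emso_models_def emso1_def fst_conv snd_conv fo_sat_foldr_Ex[OF distinct_upt]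
      fo_sat_name_preds[OF vars] fo_sat_tower_fo set_upt
    by simp
  also have "\<dots> \<longleftrightarrow> (\<exists>X u. X \<subseteq> {1..n} \<and> (\<forall>k<7. u k \<in> {1..n}) \<and> tower {1..n} E (named_preds E X u))"
    (is "?L \<longleftrightarrow> ?R")
  proof
    assume ?L
    then obtain S b where "S 0 \<subseteq> {1..n}" "\<forall>x\<in>{3..<10}. b x \<in> {1..n}"
        "tower {1..n} E (named_preds E (S (0::nat)) (\<lambda>k. b (3 + k)))"
      by blast
    then show ?R
      by (intro exI[of _ "S 0"] exI[of _ "\<lambda>k. b (3 + k)"]) auto
  next
    assume ?R
    then obtain X u where *: "X \<subseteq> {1..n}" "\<forall>k<7. u k \<in> {1..n}" "tower {1..n} E (named_preds E X u)"
      by blast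
    \<comment> \<open>Variables 3 to 9 carry \<open>u\<close>; all others keep the value 0 of the
      initial assignment in \<open>emso_models\<close>. Agreement of the predicates below 13 is
      enough, since \<open>tower_fo\<close> mentions no others.\<close>
    define b where "b = (\<lambda>x::nat. if x \<in> {3..<10} then u (x - 3) else 0)"
    have "named_preds E X (\<lambda>k. b (3 + k)) k = named_preds E X u k" if "k < 13" for k
      using that by (auto simp: named_preds_def b_def)
    then have "fo_sat {1..n} E (named_preds E X (\<lambda>k. b (3 + k))) (\<lambda>_. 0) tower_fo \<longleftrightarrow>
        fo_sat {1..n} E (named_preds E X u) (\<lambda>_. 0) tower_fo"
      using tower_fo_syntax(2) by (intro fo_sat_cong_preds) auto
    then have "tower {1..n} E (named_preds E X (\<lambda>k. b (3 + k)))"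
      using *(3) by (simp add: fo_sat_tower_fo)
    then show ?L
      using * by (intro exI[of _ "\<lambda>_. X"] conjI exI[of _ b]) (auto simp: b_def)
  qed
  finally show ?thesis .
qed

text \<open>The named predicates are particular subsets of the vertices, hence witnesses for
  \<open>emso3\<close>. So it suffices to bound the probability of \<open>emso3\<close> from above
  and that of \<open>emso1\<close> from below.\<close>

lemma emso1_imp_emso3:
  assumes "emso_models n E emso1"
  shows "emso_models n E emso3"
proof -
  obtain X u where *: "X \<subseteq> {1..n}" "\<forall>k<7. u k \<in> {1..n}" "tower {1..n} E (named_preds E X u)"
    using assms unfolding emso1_models_iff by auto
  have "named_preds E X u i \<subseteq> {1..n}" if "i < 13" for i
    using *(1,2) that by (auto simp: named_preds_def)
  with *(3) show ?thesis
    unfolding emso3_models_iff by (intro exI[of _ "named_preds E X u"]) auto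
qed

section \<open>Level sizes and the bounds they imply\<close>

context tower
begin

definition members :: "nat \<Rightarrow> nat \<Rightarrow> nat set" where
  "members k t = {x \<in> V. x \<in> S k \<and> adj x t}"

lemma next_tokens: "next s t \<Longrightarrow> s \<in> S 3 \<and> t \<in> S 3"
  by (simp add: next_def)

text \<open>Sending an element to its pair of parents is a bijection onto the pairs of the level
  below: well defined by \<open>parents\<close> and \<open>parent_unique\<close>, injective by
  \<open>split_by_prev\<close>, surjective by \<open>child_exists\<close>.\<close>

lemma members_prod:
  assumes st: "s \<in> V" "t \<in> V" "next s t" and k: "k = 0 \<or> k = 1"
    and nb: "\<not> (t \<in> S 4 \<and> t \<in> S 5)"
  shows "card (members k t) = card (members 0 s) * card (members 1 s)"
proof -
  have tok: "s \<in> S 3" "t \<in> S 3"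
    using next_tokens[OF st(3)] by auto
  have elem: "elem z" if "z \<in> members k t" for z
    using that k by (auto simp: members_def elem_def)
  have not_bottom: "\<not> bottom z" if "z \<in> members k t" for z
    using that elem[OF that] token_unique[of z t] tok nb st(2) unfolding bottom_def members_def by blast
  \<comment> \<open>\<open>prev_level\<close> quantifies over tokens; uniqueness of the token and of
    its predecessor leaves only \<open>t\<close> and \<open>s\<close>.\<close>
  have prev_level_iff: "prev_level z y \<longleftrightarrow> adj s y" if "z \<in> members k t" for z y
  proof
    assume "prev_level z y"
    then obtain t' s' where "t' \<in> V" "s' \<in> V" "adj z t'" "next s' t'" "adj s' y"
      by (auto simp: prev_level_def)
    moreover from this have "t' = t"
      using that elem[OF that] token_unique[of z t' t] tok st(2) next_tokens by (auto simp: members_def)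
    ultimately show "adj s y"
      using prev_unique st by blast
  next
    assume "adj s y"
    then show "prev_level z y"
      using that st by (auto simp: prev_level_def members_def)
  qed
  define f where "f z = ((THE y. y \<in> V \<and> y \<in> S 0 \<and> parent z y), (THE y. y \<in> V \<and> y \<in> S 1 \<and> parent z y))" for z
  have f: "f z = (x, y)" if "z \<in> members k t" "x \<in> V" "x \<in> S 0" "parent z x" "y \<in> V" "y \<in> S 1" "parent z y" for z x y
    unfolding f_def using that elem[OF that(1)] parent_unique[of z]
    by (auto simp: members_def same_kind_def intro!: the_equality)
  have ex: "\<exists>x y. f z = (x, y) \<and> x \<in> members 0 s \<and> y \<in> members 1 s \<and> parent z x \<and> parent z y"
    if z: "z \<in> members k t" for z
  proof -
    obtain x y where xy: "x \<in> V" "x \<in> S 0" "parent z x" "y \<in> V" "y \<in> S 1" "parent z y"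
      using parents[of z] not_bottom[OF z] elem[OF z] z by (auto simp: members_def)
    then have "adj s x" "adj s y"
      using prev_level_iff[OF z] by (auto simp: parent_def)
    then show ?thesis
      using f[OF z xy] xy by (auto simp: members_def adj_commute)
  qed
  have inj: "inj_on f (members k t)"
  proof (rule inj_onI, rule ccontr)
    fix z z' assume z: "z \<in> members k t" "z' \<in> members k t" and eq: "f z = f z'" and ne: "z \<noteq> z'"
    obtain x y where xy: "x \<in> members 0 s" "y \<in> members 1 s" "parent z x" "parent z y" "parent z' x" "parent z' y"
      using ex[OF z(1)] ex[OF z(2)] eq by auto
    have "same_kind z z'" "same_level z z'"
      using z k tok st by (auto simp: members_def same_kind_def same_level_def)
    \<comment> \<open>\<open>w\<close> is adjacent to exactly one of \<open>z\<close>,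
      \<open>z'\<close>, hence a parent of exactly one of them; but the only parents of either are
      \<open>x\<close> and \<open>y\<close>, which they share.\<close>
    then obtain w where w: "w \<in> V" "elem w" "prev_level z w" "splits w z z'"
      using split_by_prev[of z z'] z ne not_bottom by (auto simp: members_def)
    have w': "prev_level z' w"
      using w(3) prev_level_iff z by blast
    have "w = x \<or> w = y" if "parent v w" "parent v x" "parent v y" "v \<in> members k t" for v
      using that w(1,2) xy(1,2) elem[OF that(4)] parent_unique[of v w]
      by (auto simp: elem_def same_kind_def members_def)
    then have "adj w z \<longleftrightarrow> adj w z'"
      using w w' xy z adj_commute unfolding parent_def by metis
    then show False
      using w(4) by (simp add: splits_def)
  qed
  have "f ` members k t = members 0 s \<times> members 1 s"
  proof
    show "f ` members k t \<subseteq> members 0 s \<times> members 1 s"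
      using ex by force
    show "members 0 s \<times> members 1 s \<subseteq> f ` members k t"
    proof clarify
      fix x y assume x: "x \<in> members 0 s" and y: "y \<in> members 1 s"
      have "same_level x y" "has_next x"
        using x y st tok by (auto simp: same_level_def has_next_def members_def)
      then obtain z where z: "z \<in> V" "z \<in> S k" "parent z x" "parent z y"
        using child_exists[of x y] x y k by (auto simp: members_def)
      \<comment> \<open>The child supplied by \<open>child_exists\<close> must be shown to lie on
        level \<open>t\<close>: its predecessor token is adjacent to \<open>x\<close>, so it is
        \<open>s\<close>, and \<open>s\<close> has only one successor.\<close>
      obtain t' s' where t': "t' \<in> V" "s' \<in> V" "adj z t'" "next s' t'" "adj s' x"
        using z by (auto simp: parent_def prev_level_def)
      have "s' = s"
        using token_unique[of x s' s] t' x tok st next_tokens[OF t'(4)] adj_commute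
        by (auto simp: members_def elem_def)
      then have "t' = t"
        using next_unique t' st by blast
      then have "z \<in> members k t"
        using z t' by (auto simp: members_def)
      moreover have "f z = (x, y)"
        using f[OF calculation] x y z by (auto simp: members_def)
      ultimately show "(x, y) \<in> f ` members k t"
        by force
    qed
  qed
  then show ?thesis
    using card_image[OF inj] by (simp add: card_cartesian_product)
qed

text \<open>On the bottom level an element is determined by its kind and mark 4, and both values of
  the mark occur.\<close>

lemma members_bottom:
  assumes "t \<in> V" "t \<in> S 3" "t \<in> S 4" "t \<in> S 5" and k: "k = 0 \<or> k = 1"
  shows "card (members k t) = 2"
proof -
  obtain x y where xy: "x \<in> members k t" "y \<in> members k t" "x \<in> S 4" "y \<notin> S 4"
    using both_marks[OF assms(1,2)] k by (auto simp: members_def)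
  have "z = x \<or> z = y" if "z \<in> members k t" for z
    using that xy assms bottom_unique[of z x] bottom_unique[of z y]
    by (auto simp: members_def same_kind_def bottom_def same_level_def)
  then have "members k t = {x, y}"
    using xy by blast
  then show ?thesis
    using xy by (auto simp: card_insert_if)
qed

text \<open>Induction on the size of the level: a level above the bottom has the square of the size
  of its predecessor. Passing to the predecessor raises neither size nor index, so the descent ends
  at the bottom; the colour records the index mod 3 on the way up.\<close>

lemma card_members:
  assumes fin: "finite V"
  shows "t \<in> V \<Longrightarrow> t \<in> S 3 \<Longrightarrow> \<exists>i. card (members 0 t) = 2 ^ 2 ^ i \<and> card (members 1 t) = 2 ^ 2 ^ i \<and>
    (t \<in> S 4 \<and> t \<in> S 5 \<longrightarrow> i = 0) \<and> (t \<in> S 4 \<and> t \<notin> S 5 \<longrightarrow> i mod 3 = 1) \<and>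
    (t \<notin> S 4 \<and> t \<in> S 5 \<longrightarrow> i mod 3 = 2) \<and> (t \<notin> S 4 \<and> t \<notin> S 5 \<longrightarrow> i mod 3 = 0)"
proof (induction "card (members 0 t)" arbitrary: t rule: less_induct)
  case less
  show ?case
  proof (cases "t \<in> S 4 \<and> t \<in> S 5")
    case True
    then show ?thesis
      using members_bottom less.prems by (intro exI[of _ 0]) auto
  next
    case False
    then obtain s where s: "s \<in> V" "next s t"
      using bottom_or_prev less.prems by blast
    have ssub: "s \<in> S 3"
      using next_tokens s by blast
    have two: "2 \<le> card (members k s)" if k: "k = 0 \<or> k = 1" for k
    proof -
      obtain x y where "x \<in> members k s" "x \<in> S 4" "y \<in> members k s" "y \<notin> S 4"
        using both_marks[OF s(1) ssub] k by (auto simp: members_def)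
      then have "x \<noteq> y"
        by blast
      have "finite (members k s)"
        using fin by (simp add: members_def)
      then have "card {x, y} \<le> card (members k s)"
        using \<open>x \<in> members k s\<close> \<open>y \<in> members k s\<close> by (intro card_mono) auto
      then show ?thesis
        using \<open>x \<noteq> y\<close> by simp
    qed
    have prod: "card (members k t) = card (members 0 s) * card (members 1 s)" if "k = 0 \<or> k = 1" for k
      using members_prod[OF s(1) less.prems(1) s(2) that] False by blast
    \<comment> \<open>Sizes grow strictly because both factors are at least 2; this replaces an
      order on the levels and excludes cycles.\<close>
    have "card (members 0 s) * 1 < card (members 0 s) * card (members 1 s)"
      using two[of 0] two[of 1] by (intro mult_strict_left_mono) auto
    then have "card (members 0 s) < card (members 0 t)"
      using prod[of 0] by simp
    from less.hyps[OF this s(1) ssub] obtain i where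
      i: "card (members 0 s) = 2 ^ 2 ^ i" "card (members 1 s) = 2 ^ 2 ^ i"
        "s \<in> S 4 \<and> s \<in> S 5 \<longrightarrow> i = 0" "s \<in> S 4 \<and> s \<notin> S 5 \<longrightarrow> i mod 3 = 1"
        "s \<notin> S 4 \<and> s \<in> S 5 \<longrightarrow> i mod 3 = 2" "s \<notin> S 4 \<and> s \<notin> S 5 \<longrightarrow> i mod 3 = 0"
      by (elim exE conjE)
    have "(2::nat) ^ 2 ^ i * 2 ^ 2 ^ i = 2 ^ 2 ^ Suc i"
      by (simp flip: power_add add: mult_2)
    then have "card (members 0 t) = 2 ^ 2 ^ Suc i" "card (members 1 t) = 2 ^ 2 ^ Suc i"
      using prod[of 0] prod[of 1] i by auto
    moreover have "t \<in> S 4 \<and> t \<notin> S 5 \<longrightarrow> Suc i mod 3 = 1" "t \<notin> S 4 \<and> t \<in> S 5 \<longrightarrow> Suc i mod 3 = 2"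
       "t \<notin> S 4 \<and> t \<notin> S 5 \<longrightarrow> Suc i mod 3 = 0"
      using s(2) i(3-6) by (auto simp: next_def mod_Suc)
    ultimately show ?thesis
      using False by (intro exI[of _ "Suc i"]) simp
  qed
qed

text \<open>Everything is read off the top level. Its token has colour 0 and not the bottom colour,
  whence \<open>3 dvd i\<close>; its B elements are the clique \<open>K\<close>.\<close>

lemma tower_bounds:
  assumes fin: "finite V"
  shows "\<exists>i K. 3 dvd i \<and> card V \<le> 2 ^ ((2 ^ 2 ^ i + 1)\<^sup>2 + 13) \<and> K \<subseteq> V \<and> card K = 2 ^ 2 ^ i \<and>
    (\<forall>x\<in>K. \<forall>y\<in>K. x \<noteq> y \<longrightarrow> {x, y} \<in> E)"
proof -
  obtain t where t: "t \<in> V" "t \<in> S 12" "t \<in> S 3" "t \<notin> S 4" "t \<notin> S 5"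
    using top_exists by blast
  obtain i where i: "card (members 0 t) = 2 ^ 2 ^ i" "card (members 1 t) = 2 ^ 2 ^ i" "3 dvd i"
    using card_members[OF fin t(1,3)] t(4,5) by (auto simp: mod_eq_0_iff_dvd)
  have finm: "finite (members k t)" for k
    using fin by (simp add: members_def)
  have top_iff: "top x \<longleftrightarrow> adj x t" for x
    using t top_unique unfolding top_def by blast
  define C where "C = {c \<in> V. c \<in> S 2}"
  have finC: "finite C"
    using fin by (simp add: C_def)
  define opt where "opt k c = {x \<in> members k t. adj c x}" for k c
  \<comment> \<open>The subsets of \<open>M\<close> with at most one element, at most
    \<open>card M + 1\<close> many; one choice for each kind gives the square.\<close>
  define small where "small M = insert {} ((\<lambda>x. {x}) ` M)" for M :: "nat set"
  have opt_small: "opt k c \<in> small (members k t)" if "c \<in> C" "k = 0 \<or> k = 1" for k c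
  proof -
    have "x = y" if "x \<in> opt k c" "y \<in> opt k c" for x y
      using that \<open>c \<in> C\<close> \<open>k = 0 \<or> k = 1\<close> top_nbr_unique[of c x y]
      by (auto simp: opt_def members_def C_def top_iff same_kind_def)
    then have "opt k c = {} \<or> (\<exists>x. opt k c = {x})"
      by blast
    moreover have "opt k c \<subseteq> members k t"
      by (auto simp: opt_def)
    ultimately show ?thesis
      by (auto simp: small_def)
  qed
  have card_small: "card (small M) \<le> card M + 1" if "finite M" for M
    unfolding small_def using that card_image_le[of M "\<lambda>x. {x}"] by (simp add: card_insert_if)
  have "inj_on (\<lambda>c. (opt 0 c, opt 1 c)) C"
  proof (rule inj_onI, rule ccontr)
    fix c c' assume c: "c \<in> C" "c' \<in> C" and eq: "(opt 0 c, opt 1 c) = (opt 0 c', opt 1 c')" and "c \<noteq> c'"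
    then obtain z where z: "z \<in> V" "elem z" "top z" "splits z c c'"
      using split_by_top[of c c'] by (auto simp: C_def)
    have "z \<in> opt k c \<longleftrightarrow> z \<in> opt k c'" if "k = 0 \<or> k = 1" for k
      using eq that by auto
    then show False
      using z adj_commute[of z] by (fastforce simp: elem_def opt_def members_def top_iff splits_def)
  qed
  moreover have "(\<lambda>c. (opt 0 c, opt 1 c)) ` C \<subseteq> small (members 0 t) \<times> small (members 1 t)"
    using opt_small by auto
  moreover have "finite (small (members 0 t) \<times> small (members 1 t))"
    using finm by (simp add: small_def)
  ultimately have "card C \<le> card (small (members 0 t) \<times> small (members 1 t))"
    by (rule card_inj_on_le)
  also have "\<dots> \<le> (2 ^ 2 ^ i + 1) * (2 ^ 2 ^ i + 1)"
    unfolding card_cartesian_product i(1)[symmetric] using card_small[OF finm[of 0]] card_small[OF finm[of 1]]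
    by (intro mult_le_mono) (simp_all add: i i(2)[simplified])
  finally have cardC: "card C \<le> (2 ^ 2 ^ i + 1)\<^sup>2"
    by (simp add: power2_eq_square)
  \<comment> \<open>The neighbours in \<open>C\<close> together with 13 bits determine a vertex, by
    \<open>split_by_C\<close>.\<close>
  define code where "code x = ({c \<in> C. adj c x}, {k. k < 13 \<and> x \<in> S k})" for x
  have "inj_on code V"
  proof (rule inj_onI, rule ccontr)
    fix x y assume x: "x \<in> V" "y \<in> V" and eq: "code x = code y" and "x \<noteq> y"
    have "same_bits x y"
      using eq by (auto simp: code_def same_bits_def)
    then obtain z where "z \<in> V" "z \<in> S 2" "splits z x y"
      using split_by_C x \<open>x \<noteq> y\<close> by blast
    moreover have "{c \<in> C. adj c x} = {c \<in> C. adj c y}"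
      using eq by (simp add: code_def)
    ultimately show False
      by (auto simp: splits_def C_def)
  qed
  moreover have "code ` V \<subseteq> Pow C \<times> Pow {..<13}"
    by (auto simp: code_def)
  moreover have "finite (Pow C \<times> Pow {..<13::nat})"
    using finC by simp
  ultimately have "card V \<le> card (Pow C \<times> Pow {..<13::nat})"
    by (rule card_inj_on_le)
  also have "\<dots> = 2 ^ (card C + 13)"
    using finC by (simp add: card_cartesian_product card_Pow power_add)
  also have "\<dots> \<le> 2 ^ ((2 ^ 2 ^ i + 1)\<^sup>2 + 13)"
    using cardC by (intro power_increasing) auto
  finally have cardV: "card V \<le> 2 ^ ((2 ^ 2 ^ i + 1)\<^sup>2 + 13)" .
  have clique: "\<forall>x\<in>members 1 t. \<forall>y\<in>members 1 t. x \<noteq> y \<longrightarrow> {x, y} \<in> E"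
    using level_clique t by (auto simp: members_def same_level_def adj_def)
  have "members 1 t \<subseteq> V"
    by (auto simp: members_def)
  then show ?thesis
    by (intro exI[of _ i] exI[of _ "members 1 t"] conjI i cardV clique)
qed

end

section \<open>An explicit tower\<close>

text \<open>\<open>Name k\<close> is the vertex whose neighbourhood traces predicate
  \<open>k\<close>, for \<open>k < 6\<close>. \<open>El \<kappa> i z\<close> is element number
  \<open>z\<close> of level \<open>i\<close>, of kind A (predicate 0) if \<open>\<kappa>\<close>
  holds and of kind B (predicate 1) otherwise.\<close>

datatype hvertex = Name nat | Token nat | El bool nat nat

abbreviation lsize :: "nat \<Rightarrow> nat" where
  "lsize i \<equiv> 2 ^ 2 ^ i"

lemma lsize_Suc: "lsize (Suc i) = lsize i * lsize i"
  by (simp flip: power_add add: mult_2)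

lemma lsize_div_mod:
  assumes "z < lsize (Suc i)"
  shows "z mod lsize i < lsize i" "z div lsize i < lsize i"
  using assms unfolding lsize_Suc by (auto intro: less_mult_imp_div_less)

lemma lsize_gt: "1 < lsize i" "0 < lsize i"
  using one_less_power[of "2::nat" "2 ^ i"] by auto

text \<open>Whether the token of level \<open>i\<close> lies in predicate 4; \<open>qbit\<close> is
  the same for predicate 5.\<close>

definition pbit :: "nat \<Rightarrow> bool" where
  "pbit i \<longleftrightarrow> i = 0 \<or> i mod 3 = 1"

definition qbit :: "nat \<Rightarrow> bool" where
  "qbit i \<longleftrightarrow> i = 0 \<or> i mod 3 = 2"

text \<open>An element number on level \<open>Suc i\<close> is a pair of digits in base
  \<open>lsize i\<close>: the low digit is the A parent, the high digit the B parent. Odd numbers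
  carry mark 4, and the B elements of a level form a clique.\<close>

fun harc :: "hvertex \<Rightarrow> hvertex \<Rightarrow> bool" where
  "harc (Token i) (Name k) \<longleftrightarrow> k = 3 \<or> k = 4 \<and> pbit i \<or> k = 5 \<and> qbit i"
| "harc (El \<kappa> i z) (Name k) \<longleftrightarrow> k = (if \<kappa> then 0 else 1) \<or> k = 4 \<and> odd z"
| "harc (Token i) (Token i') \<longleftrightarrow> i' = Suc i"
| "harc (El \<kappa> i z) (Token i') \<longleftrightarrow> i = i'"
| "harc (El \<kappa> i z) (El \<kappa>' i' z') \<longleftrightarrow> \<not> \<kappa> \<and> \<not> \<kappa>' \<and> i = i' \<and> z \<noteq> z' \<or>
     i = Suc i' \<and> z' = (if \<kappa>' then z mod lsize i' else z div lsize i')"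
| "harc _ _ \<longleftrightarrow> False"

definition hedge :: "hvertex \<Rightarrow> hvertex \<Rightarrow> bool" where
  "hedge h h' \<longleftrightarrow> harc h h' \<or> harc h' h"

definition tokens :: "nat \<Rightarrow> hvertex set" where
  "tokens j = Token ` {..j}"

definition els :: "nat \<Rightarrow> hvertex set" where
  "els j = (\<Union>i\<in>{..j}. \<Union>\<kappa>\<in>UNIV. El \<kappa> i ` {..<lsize i})"

definition hverts :: "nat \<Rightarrow> hvertex set" where
  "hverts j = Name ` {..<6} \<union> tokens j \<union> els j"

definition lower :: "nat \<Rightarrow> hvertex set" where
  "lower j = tokens j \<union> (\<Union>i\<in>{..<j}. \<Union>\<kappa>\<in>UNIV. El \<kappa> i ` {..<lsize i})"

text \<open>Neighbours in the tower of the separating vertex with index \<open>(p, q)\<close>. On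
  the top level these are A element \<open>p\<close> and B element \<open>q\<close>. If
  \<open>q = 0\<close> it also sees the vertex of \<open>lower j\<close> with code \<open>p\<close>,
  so that tokens and lower elements can be told apart as well.\<close>

fun cpat :: "nat \<Rightarrow> (hvertex \<Rightarrow> nat) \<Rightarrow> nat \<Rightarrow> nat \<Rightarrow> hvertex \<Rightarrow> bool" where
  "cpat j code p q (Name k) \<longleftrightarrow> k = 2"
| "cpat j code p q (Token i) \<longleftrightarrow> q = 0 \<and> code (Token i) = p"
| "cpat j code p q (El \<kappa> i z) \<longleftrightarrow>
     (if i = j then z = (if \<kappa> then p else q) else q = 0 \<and> code (El \<kappa> i z) = p)"

lemma hverts_simps [simp]:
  "Name k \<in> hverts j \<longleftrightarrow> k < 6" "Token i \<in> hverts j \<longleftrightarrow> i \<le> j" "El \<kappa> i z \<in> hverts j \<longleftrightarrow> i \<le> j \<and> z < lsize i"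
  by (auto simp: hverts_def tokens_def els_def image_iff)

lemma lower_simps [simp]:
  "Name k \<notin> lower j" "Token i \<in> lower j \<longleftrightarrow> i \<le> j" "El \<kappa> i z \<in> lower j \<longleftrightarrow> i < j \<and> z < lsize i"
  by (auto simp: lower_def tokens_def image_iff)

lemma hedge_simps [simp]:
  "\<not> hedge (Name k) (Name k')"
  "hedge (Token i) (Name k) \<longleftrightarrow> k = 3 \<or> k = 4 \<and> pbit i \<or> k = 5 \<and> qbit i"
  "hedge (El \<kappa> i z) (Name k) \<longleftrightarrow> k = (if \<kappa> then 0 else 1) \<or> k = 4 \<and> odd z"
  "hedge (Token i) (Token i') \<longleftrightarrow> i' = Suc i \<or> i = Suc i'"
  "hedge (El \<kappa> i z) (Token i') \<longleftrightarrow> i = i'"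
  "hedge (Token i') (El \<kappa> i z) \<longleftrightarrow> i = i'"
  by (auto simp: hedge_def)

text \<open>Lower vertices differ in their codes at \<open>q = 0\<close>, top elements in their own
  numbers. Vertices of different roles are left to the predicates, hence the hypothesis
  \<open>kind\<close>.\<close>

lemma cpat_distinguishes:
  assumes code: "inj_on code (lower j)" "code ` lower j \<subseteq> {..<lsize j}"
    and h: "h \<in> hverts j" "h' \<in> hverts j" "h \<noteq> h'"
    and kind: "(\<exists>i i'. h = Token i \<and> h' = Token i') \<or> (\<exists>\<kappa> i z i' z'. h = El \<kappa> i z \<and> h' = El \<kappa> i' z')"
  shows "\<exists>p<lsize j. \<exists>q<lsize j. cpat j code p q h \<noteq> cpat j code p q h'"
proof -
  note two = lsize_gt[of j]
  have both_lower: ?thesis if l: "h \<in> lower j" "h' \<in> lower j"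
  proof -
    have "code h < lsize j" "code h \<noteq> code h'"
      using l code h(3) by (auto simp: inj_on_def)
    moreover have "cpat j code (code h) 0 h" "\<not> cpat j code (code h) 0 h'"
      using l kind calculation by auto
    ultimately show ?thesis
      using two by blast
  qed
  have one_top: "\<exists>p<lsize j. \<exists>q<lsize j. cpat j code p q (El \<kappa> j z) \<noteq> cpat j code p q (El \<kappa> i' z')"
    if "z < lsize j" "i' < j" for \<kappa> z i' z'
  proof (cases \<kappa>)
    case True
    \<comment> \<open>The index \<open>q = 1\<close> hides everything below the top level.\<close>
    then have "cpat j code z 1 (El \<kappa> j z) \<noteq> cpat j code z 1 (El \<kappa> i' z')"
      using that by simp
    then show ?thesis
      using that two by blast
  next
    case False
    \<comment> \<open>For a B element the second index is forced to be \<open>z\<close>, possibly 0,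
      so \<open>p\<close> has to avoid the code of the lower element.\<close>
    define p :: nat where "p = (if code (El \<kappa> i' z') = 0 then 1 else 0)"
    have "p < lsize j" "cpat j code p z (El \<kappa> j z) \<noteq> cpat j code p z (El \<kappa> i' z')"
      using False that two by (auto simp: p_def)
    then show ?thesis
      using that by blast
  qed
  from kind show ?thesis
  proof (elim disjE exE conjE)
    fix i i' assume "h = Token i" "h' = Token i'"
    then show ?thesis
      using h both_lower by simp
  next
    fix \<kappa> i z i' z' assume hh: "h = El \<kappa> i z" "h' = El \<kappa> i' z'"
    consider "i < j" "i' < j" | "i = j" "i' < j" | "i < j" "i' = j" | "i = j" "i' = j"
      using h hh by fastforce
    then show ?thesis
    proof cases
      case 1
      then show ?thesis
        using h hh both_lower by simp
    next
      case 2
      then show ?thesis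
        using h hh one_top by simp
    next
      case 3
      then show ?thesis
        using h hh one_top[of z' i \<kappa> z] by (metis hverts_simps(3))
    next
      case 4
      then have "z \<noteq> z'" "z < lsize j"
        using h hh by auto
      then show ?thesis
        using 4 hh two
        by (intro exI[of _ "if \<kappa> then z else 0"] exI[of _ "if \<kappa> then 0 else z"] conjI) auto
    qed
  qed
qed

text \<open>What the random graph has to provide: an induced copy of the explicit tower, and
  vertices \<open>c p q\<close> with prescribed neighbours in the copy that separate all vertices
  outside it. The \<open>c p q\<close> themselves are outside and so are covered by
  \<open>c_sep\<close>.\<close>

locale tower_model =
  fixes V :: "nat set" and E :: "nat set set" and j :: nat and f :: "hvertex \<Rightarrow> nat"
    and c :: "nat \<Rightarrow> nat \<Rightarrow> nat" and code :: "hvertex \<Rightarrow> nat"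
  assumes j: "3 dvd j" "0 < j"
    and f_inj: "inj_on f (hverts j)"
    and f_V: "h \<in> hverts j \<Longrightarrow> f h \<in> V"
    and f_edge: "\<lbrakk>h \<in> hverts j; h' \<in> hverts j\<rbrakk> \<Longrightarrow> {f h, f h'} \<in> E \<longleftrightarrow> hedge h h'"
    and c_V: "\<lbrakk>p < lsize j; q < lsize j\<rbrakk> \<Longrightarrow> c p q \<in> V - f ` hverts j"
    and c_edge: "\<lbrakk>p < lsize j; q < lsize j; h \<in> hverts j\<rbrakk> \<Longrightarrow> {c p q, f h} \<in> E \<longleftrightarrow> cpat j code p q h"
    and code: "inj_on code (lower j)" "code ` lower j \<subseteq> {..<lsize j}"
    and c_sep: "\<lbrakk>x \<in> V - f ` hverts j; y \<in> V - f ` hverts j; x \<noteq> y\<rbrakk> \<Longrightarrow>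
       \<exists>p<lsize j. \<exists>q<lsize j. {c p q, x} \<in> E \<longleftrightarrow> {c p q, y} \<notin> E"
begin

text \<open>The names stay outside \<open>X\<close> and hence outside predicates 0 to 5; they are
  recognised by their singletons.\<close>

definition X :: "nat set" where
  "X = f ` (tokens j \<union> els j) \<union> {c p q | p q. p < lsize j \<and> q < lsize j}"

definition u :: "nat \<Rightarrow> nat" where
  "u k = (if k < 6 then f (Name k) else f (Token j))"

abbreviation S :: "nat \<Rightarrow> nat set" where
  "S \<equiv> named_preds E X u"

sublocale coloured_graph V E S .

lemma f_eq_iff: "h \<in> hverts j \<Longrightarrow> h' \<in> hverts j \<Longrightarrow> f h = f h' \<longleftrightarrow> h = h'"
  using f_inj by (auto simp: inj_on_def)

lemma adj_f: "h \<in> hverts j \<Longrightarrow> h' \<in> hverts j \<Longrightarrow> adj (f h) (f h') \<longleftrightarrow> hedge h h'"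
  unfolding adj_def by (rule f_edge)

lemma adj_c: "p < lsize j \<Longrightarrow> q < lsize j \<Longrightarrow> h \<in> hverts j \<Longrightarrow> adj (c p q) (f h) \<longleftrightarrow> cpat j code p q h"
  unfolding adj_def by (rule c_edge)

lemma X_cases:
  assumes "x \<in> X"
  obtains i where "i \<le> j" "x = f (Token i)"
  | \<kappa> i z where "i \<le> j" "z < lsize i" "x = f (El \<kappa> i z)"
  | p q where "p < lsize j" "q < lsize j" "x = c p q"
  using assms unfolding X_def tokens_def els_def by blast

lemma X_intros:
  "i \<le> j \<Longrightarrow> f (Token i) \<in> X" "i \<le> j \<Longrightarrow> z < lsize i \<Longrightarrow> f (El \<kappa> i z) \<in> X"
  "p < lsize j \<Longrightarrow> q < lsize j \<Longrightarrow> c p q \<in> X"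
  unfolding X_def tokens_def els_def by blast+

lemma mem_S_less_6: "k < 6 \<Longrightarrow> x \<in> S k \<longleftrightarrow> x \<in> X \<and> adj x (f (Name k))"
  by (simp add: named_preds_def u_def adj_def)

lemma S_token: "i \<le> j \<Longrightarrow> k < 6 \<Longrightarrow> f (Token i) \<in> S k \<longleftrightarrow> k = 3 \<or> k = 4 \<and> pbit i \<or> k = 5 \<and> qbit i"
  by (simp add: mem_S_less_6 X_intros adj_f)

lemma S_el: "i \<le> j \<Longrightarrow> z < lsize i \<Longrightarrow> k < 6 \<Longrightarrow>
    f (El \<kappa> i z) \<in> S k \<longleftrightarrow> k = (if \<kappa> then 0 else 1) \<or> k = 4 \<and> odd z"
  by (simp add: mem_S_less_6 X_intros adj_f)

lemma S_c: "p < lsize j \<Longrightarrow> q < lsize j \<Longrightarrow> k < 6 \<Longrightarrow> c p q \<in> S k \<longleftrightarrow> k = 2"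
  by (simp add: mem_S_less_6 X_intros adj_c)

lemma S_subset_X: "k < 6 \<Longrightarrow> S k \<subseteq> X"
  using mem_S_less_6 by blast

lemma mem_S0: "x \<in> S 0 \<longleftrightarrow> (\<exists>i\<le>j. \<exists>z<lsize i. x = f (El True i z))"
proof
  assume x: "x \<in> S 0"
  then have "x \<in> X" using S_subset_X[of 0] by auto
  then show "\<exists>i\<le>j. \<exists>z<lsize i. x = f (El True i z)"
    by (cases rule: X_cases) (use x in \<open>auto simp: S_token S_el S_c split: if_splits\<close>)
qed (auto simp: S_el)

lemma mem_S1: "x \<in> S 1 \<longleftrightarrow> (\<exists>i\<le>j. \<exists>z<lsize i. x = f (El False i z))"
proof
  assume x: "x \<in> S 1"
  then have "x \<in> X" using S_subset_X[of 1] by auto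
  then show "\<exists>i\<le>j. \<exists>z<lsize i. x = f (El False i z)"
    by (cases rule: X_cases) (use x in \<open>auto simp: S_token S_el S_c split: if_splits\<close>)
qed (auto simp: S_el)

lemma mem_S2: "x \<in> S 2 \<longleftrightarrow> (\<exists>p<lsize j. \<exists>q<lsize j. x = c p q)"
proof
  assume x: "x \<in> S 2"
  then have "x \<in> X" using S_subset_X[of 2] by auto
  then show "\<exists>p<lsize j. \<exists>q<lsize j. x = c p q"
    by (cases rule: X_cases) (use x in \<open>auto simp: S_token S_el S_c split: if_splits\<close>)
qed (auto simp: S_c)

lemma mem_S3: "x \<in> S 3 \<longleftrightarrow> (\<exists>i\<le>j. x = f (Token i))"
proof
  assume x: "x \<in> S 3"
  then have "x \<in> X" using S_subset_X[of 3] by auto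
  then show "\<exists>i\<le>j. x = f (Token i)"
    by (cases rule: X_cases) (use x in \<open>auto simp: S_token S_el S_c split: if_splits\<close>)
qed (auto simp: S_token)

lemma mem_S12: "x \<in> S 12 \<longleftrightarrow> x = f (Token j)"
  by (auto simp: named_preds_def u_def)

lemma elem_iff: "elem x \<longleftrightarrow> (\<exists>\<kappa>. \<exists>i\<le>j. \<exists>z<lsize i. x = f (El \<kappa> i z))"
  unfolding elem_def mem_S0 mem_S1 ex_bool_eq by blast

lemma same_kind_iff: "same_kind x y \<longleftrightarrow>
    (\<exists>\<kappa>. (\<exists>i\<le>j. \<exists>z<lsize i. x = f (El \<kappa> i z)) \<and> (\<exists>i\<le>j. \<exists>z<lsize i. y = f (El \<kappa> i z)))"
  unfolding same_kind_def mem_S0 mem_S1 ex_bool_eq by blast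

lemma next_iff: "next s t \<longleftrightarrow> (\<exists>i<j. s = f (Token i) \<and> t = f (Token (Suc i)))"
proof
  assume nxt: "next s t"
  then obtain i i' where i: "i \<le> j" "i' \<le> j" "s = f (Token i)" "t = f (Token i')"
    unfolding next_def mem_S3 by blast
  have "i' = Suc i \<or> i = Suc i'"
    using nxt i by (auto simp: next_def adj_f)
  moreover have "(pbit i \<longleftrightarrow> qbit i) \<and> pbit i' \<and> \<not> qbit i' \<or> pbit i \<and> \<not> qbit i \<and> \<not> pbit i' \<and> qbit i' \<or>
      \<not> pbit i \<and> qbit i \<and> \<not> pbit i' \<and> \<not> qbit i'"
    using nxt i by (auto simp: next_def S_token)
  \<comment> \<open>The colours exclude \<open>i = Suc i'\<close>: mod 3, going down by one level
    differs from going up by one.\<close>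
  ultimately have "i' = Suc i"
    by (auto simp: pbit_def qbit_def mod_Suc split: if_splits)
  then show "\<exists>i<j. s = f (Token i) \<and> t = f (Token (Suc i))"
    using i by (intro exI[of _ i]) auto
next
  assume "\<exists>i<j. s = f (Token i) \<and> t = f (Token (Suc i))"
  then obtain i where i: "i < j" "s = f (Token i)" "t = f (Token (Suc i))"
    by blast
  have "i mod 3 = 0 \<or> i mod 3 = 1 \<or> i mod 3 = 2"
    by linarith
  then show "next s t"
    using i by (auto simp: next_def S_token adj_f pbit_def qbit_def mod_Suc)
qed

context
  fixes \<kappa> :: bool and i z :: nat
  assumes h: "i \<le> j" "z < lsize i"
begin

lemma el_token: "t \<in> S 3 \<and> adj (f (El \<kappa> i z)) t \<longleftrightarrow> t = f (Token i)"
  using h by (auto simp: mem_S3 adj_f)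

lemma bottom_el: "bottom (f (El \<kappa> i z)) \<longleftrightarrow> i = 0"
proof -
  have "bottom (f (El \<kappa> i z)) \<longleftrightarrow> f (Token i) \<in> S 4 \<and> f (Token i) \<in> S 5"
    unfolding bottom_def using el_token f_V[of "Token i"] h by (metis hverts_simps(2))
  then show ?thesis
    using h by (auto simp: S_token pbit_def qbit_def)
qed

lemma top_el: "top (f (El \<kappa> i z)) \<longleftrightarrow> i = j"
  unfolding top_def mem_S12 using h f_V[of "Token j"] by (auto simp: adj_f)

lemma has_next_el: "has_next (f (El \<kappa> i z)) \<longleftrightarrow> i < j"
proof
  assume "has_next (f (El \<kappa> i z))"
  then obtain i' where "i' < j" "adj (f (El \<kappa> i z)) (f (Token i'))"
    unfolding has_next_def next_iff by blast
  then show "i < j"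
    using h by (simp add: adj_f)
next
  assume "i < j"
  then show "has_next (f (El \<kappa> i z))"
    unfolding has_next_def next_iff using h f_V[of "Token i"] f_V[of "Token (Suc i)"]
    by (intro bexI[of _ "f (Token i)"] conjI bexI[of _ "f (Token (Suc i))"] exI[of _ i]) (auto simp: adj_f)
qed

lemma prev_level_el: "prev_level (f (El \<kappa> i z)) y \<longleftrightarrow> (\<exists>i'. i = Suc i' \<and> adj (f (Token i')) y)"
proof
  assume "prev_level (f (El \<kappa> i z)) y"
  then obtain i' where "i' < j" "adj (f (El \<kappa> i z)) (f (Token (Suc i')))" "adj (f (Token i')) y"
    unfolding prev_level_def next_iff by blast
  then show "\<exists>i'. i = Suc i' \<and> adj (f (Token i')) y"
    using h by (auto simp: adj_f)
next
  assume "\<exists>i'. i = Suc i' \<and> adj (f (Token i')) y"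
  then obtain i' where "i = Suc i'" "adj (f (Token i')) y"
    by blast
  then show "prev_level (f (El \<kappa> i z)) y"
    unfolding prev_level_def next_iff using h f_V[of "Token i'"] f_V[of "Token i"]
    by (intro bexI[of _ "f (Token i)"] conjI bexI[of _ "f (Token i')"] exI[of _ i']) (auto simp: adj_f)
qed

lemma same_level_el: "same_level (f (El \<kappa> i z)) y \<longleftrightarrow> adj y (f (Token i))"
  unfolding same_level_def using el_token f_V[of "Token i"] h by (metis hverts_simps(2))

lemma parent_el:
  assumes "i' \<le> j" "z' < lsize i'"
  shows "parent (f (El \<kappa> i z)) (f (El \<kappa>' i' z')) \<longleftrightarrow>
    i = Suc i' \<and> z' = (if \<kappa>' then z mod lsize i' else z div lsize i')"
  using h assms by (auto simp: parent_def prev_level_el adj_f hedge_def split: if_splits)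

end

lemma same_level_els: "\<lbrakk>i \<le> j; z < lsize i; i' \<le> j; z' < lsize i'\<rbrakk> \<Longrightarrow>
    same_level (f (El \<kappa> i z)) (f (El \<kappa>' i' z')) \<longleftrightarrow> i = i'"
  by (auto simp: same_level_el adj_f)

lemma el_V: "\<lbrakk>i \<le> j; z < lsize i\<rbrakk> \<Longrightarrow> f (El \<kappa> i z) \<in> V"
  by (rule f_V) simp

lemma mem_S0_el: "i \<le> j \<Longrightarrow> z < lsize i \<Longrightarrow> f (El \<kappa> i z) \<in> S 0 \<longleftrightarrow> \<kappa>"
  and mem_S1_el: "i \<le> j \<Longrightarrow> z < lsize i \<Longrightarrow> f (El \<kappa> i z) \<in> S 1 \<longleftrightarrow> \<not> \<kappa>"
  by (simp_all add: S_el)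

text \<open>The singletons identify the names, predicate 3 the tokens, and predicates 0 and 1 the
  elements together with their kind.\<close>

lemma same_bits_hverts:
  assumes "same_bits x y" "h \<in> hverts j" "x = f h"
  shows "(\<exists>k. h = Name k \<and> y = x) \<or> (\<exists>i i'. i' \<le> j \<and> h = Token i \<and> y = f (Token i')) \<or>
    (\<exists>\<kappa> i z i' z'. i' \<le> j \<and> z' < lsize i' \<and> h = El \<kappa> i z \<and> y = f (El \<kappa> i' z'))"
proof (cases h)
  case (Name k)
  then have "x \<in> S (k + 6)" "k + 6 < 13"
    using assms by (auto simp: named_preds_def u_def)
  then have "y \<in> S (k + 6)"
    using assms(1) by (simp add: same_bits_def)
  then show ?thesis
    using Name assms by (auto simp: named_preds_def u_def)
next
  case (Token i)
  then have "x \<in> S 3"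
    using assms by (auto simp: mem_S3)
  then have "y \<in> S 3"
    using assms(1) by (simp add: same_bits_def)
  then show ?thesis
    using Token by (auto simp: mem_S3)
next
  case (El \<kappa> i z)
  then have "x \<in> S (if \<kappa> then 0 else 1)"
    using assms by (simp add: S_el)
  then have "y \<in> S (if \<kappa> then 0 else 1)"
    using assms(1) by (simp add: same_bits_def)
  then obtain i' z' where "i' \<le> j" "z' < lsize i'" "y = f (El \<kappa> i' z')"
    by (cases \<kappa>) (auto simp: mem_S0 mem_S1[simplified])
  then show ?thesis
    using El by blast
qed

text \<open>Two vertices of the copy with equal bits have the same role and are split by their
  patterns; two vertices outside it are split by \<open>c_sep\<close>; a mixed pair never has equal
  bits.\<close>

lemma same_bits_split:
  assumes "x \<in> V" "y \<in> V" "same_bits x y" "x \<noteq> y"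
  shows "\<exists>z\<in>V. z \<in> S 2 \<and> splits z x y"
proof -
  have c_S2: "c p q \<in> V \<and> c p q \<in> S 2" if "p < lsize j" "q < lsize j" for p q
    using that c_V[OF that] by (auto simp: mem_S2)
  have sym: "same_bits y x"
    using assms(3) by (simp add: same_bits_def)
  show ?thesis
  proof (cases "x \<in> f ` hverts j")
    case True
    then obtain h where h: "h \<in> hverts j" "x = f h"
      by blast
    then obtain h' where h': "h' \<in> hverts j" "y = f h'"
       "(\<exists>i i'. h = Token i \<and> h' = Token i') \<or> (\<exists>\<kappa> i z i' z'. h = El \<kappa> i z \<and> h' = El \<kappa> i' z')"
      using same_bits_hverts[OF assms(3) h] assms(4)
    proof (elim disjE exE conjE)
      fix i i' assume "i' \<le> j" "h = Token i" "y = f (Token i')"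
      then show ?thesis
        using that[of "Token i'"] by simp
    next
      fix \<kappa> i z i' z' assume "i' \<le> j" "z' < lsize i'" "h = El \<kappa> i z" "y = f (El \<kappa> i' z')"
      then show ?thesis
        using that[of "El \<kappa> i' z'"] by simp
    qed simp
    then obtain p q where pq: "p < lsize j" "q < lsize j" "cpat j code p q h \<noteq> cpat j code p q h'"
      using cpat_distinguishes[OF code h(1) h'(1)] h assms(4) by blast
    then have "splits (c p q) x y"
      using h h' by (auto simp: splits_def adj_c)
    then show ?thesis
      using c_S2 pq by blast
  next
    case False
    moreover have "y \<notin> f ` hverts j"
    proof
      assume "y \<in> f ` hverts j"
      then obtain h where "h \<in> hverts j" "y = f h"
        by blast
      from same_bits_hverts[OF sym this] show False
        using False assms(4) by (auto simp: image_iff)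
    qed
    ultimately obtain p q where "p < lsize j" "q < lsize j" "{c p q, x} \<in> E \<longleftrightarrow> {c p q, y} \<notin> E"
      using c_sep[of x y] assms by blast
    then show ?thesis
      using c_S2 unfolding splits_def adj_def by blast
  qed
qed

text \<open>The case numbers follow the order of the assumptions of \<open>tower\<close>.\<close>

lemma is_tower: "tower V E S"
proof (unfold_locales, goal_cases)
  case (1 x t t')
  then show ?case
    unfolding elem_iff using el_token by (metis (no_types, lifting))
next
  case (2 s t t')
  then show ?case
    unfolding next_iff by (auto simp: f_eq_iff)
next
  case (3 s s' t)
  then show ?case
    unfolding next_iff by (auto simp: f_eq_iff)
next
  case (4 t)
  then obtain i where i: "i \<le> j" "t = f (Token i)"
    by (auto simp: mem_S3)
  \<comment> \<open>Numbers 0 and 1 exist on every level and have different parity, hence different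
    marks.\<close>
  note w = lsize_gt[of i]
  have "f (El \<kappa> i b) \<in> V \<and> (f (El \<kappa> i b) \<in> S 4 \<longleftrightarrow> odd b) \<and> adj (f (El \<kappa> i b)) t" if "b < lsize i" for \<kappa> b
    using i el_V[OF i(1) that] that by (simp add: S_el adj_f)
  from this[OF w(1)] this[OF w(2)] show ?case
    using mem_S0_el[OF i(1) w(1)] mem_S0_el[OF i(1) w(2)] mem_S1_el[OF i(1) w(1)] mem_S1_el[OF i(1) w(2)]
    by (metis even_zero odd_one)
next
  case (5 t)
  then obtain i where i: "i \<le> j" "t = f (Token i)"
    by (auto simp: mem_S3)
  show ?case
  proof (cases i)
    case 0
    then show ?thesis
      using i by (simp add: S_token pbit_def qbit_def)
  next
    case (Suc i')
    then have "next (f (Token i')) t" "f (Token i') \<in> V"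
      using i f_V[of "Token i'"] by (auto simp: next_iff intro!: exI[of _ i'])
    then show ?thesis
      by blast
  qed
next
  case (6 x y)
  then obtain \<kappa> i z i' z' where *: "i \<le> j" "z < lsize i" "x = f (El \<kappa> i z)" "i' \<le> j" "z' < lsize i'" "y = f (El \<kappa> i' z')"
    unfolding same_kind_iff by blast
  with 6 have "i = 0" "i' = 0"
    by (auto simp: bottom_el same_level_els)
  then show ?case
    using * 6(4) by (auto simp: S_el less_2_cases_iff split: if_splits)
next
  case (7 x)
  then obtain \<kappa> i z where *: "i \<le> j" "z < lsize i" "x = f (El \<kappa> i z)"
    unfolding elem_iff by blast
  show ?case
  proof (cases i)
    case 0
    then show ?thesis
      using * by (simp add: bottom_el)
  next
    case (Suc i')
    have z: "z mod lsize i' < lsize i'" "z div lsize i' < lsize i'" "i' \<le> j"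
      using *(1,2) lsize_div_mod[of z i'] unfolding Suc by auto
    have "parent x (f (El True i' (z mod lsize i')))" "parent x (f (El False i' (z div lsize i')))"
      using * Suc z by (auto simp: parent_el)
    moreover have "f (El True i' (z mod lsize i')) \<in> S 0" "f (El False i' (z div lsize i')) \<in> S 1"
      using mem_S0_el[OF z(3,1), of True] mem_S1_el[OF z(3,2), of False] by auto
    moreover note el_V[OF z(3,1), of True] el_V[OF z(3,2), of False]
    ultimately show ?thesis
      by blast
  qed
next
  case (8 x y w)
  then obtain \<kappa> i z \<kappa>' i1 z1 i2 z2 where *: "i \<le> j" "z < lsize i" "x = f (El \<kappa> i z)"
      "i1 \<le> j" "z1 < lsize i1" "y = f (El \<kappa>' i1 z1)" "i2 \<le> j" "z2 < lsize i2" "w = f (El \<kappa>' i2 z2)"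
    unfolding same_kind_iff elem_iff by blast
  with 8 show ?case
    by (auto simp: parent_el)
next
  case (9 x y)
  then obtain \<kappa> i z i' z' where *: "i \<le> j" "z < lsize i" "x = f (El \<kappa> i z)" "i' \<le> j" "z' < lsize i'" "y = f (El \<kappa> i' z')"
    unfolding same_kind_iff by blast
  with 9 have "i' = i" "i \<noteq> 0"
    by (auto simp: bottom_el same_level_els)
  then obtain k where k: "i = Suc k" "i' = Suc k"
    using not0_implies_Suc by blast
  have z: "z mod lsize k < lsize k" "z div lsize k < lsize k" "k \<le> j"
    using *(1,2) lsize_div_mod[of z k] unfolding k by auto
  have "z \<noteq> z'"
    using 9 * k by auto
  then have "z mod lsize k \<noteq> z' mod lsize k \<or> z div lsize k \<noteq> z' div lsize k"
    by (metis div_mult_mod_eq)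
  \<comment> \<open>Distinct numbers differ in a digit, and the element of the level below named by
    that digit is a parent of only one of them.\<close>
  then obtain \<kappa>' w where w: "w < lsize k" "(w = (if \<kappa>' then z mod lsize k else z div lsize k)) \<noteq>
      (w = (if \<kappa>' then z' mod lsize k else z' div lsize k))"
    using z by (metis (full_types))
  have "splits (f (El \<kappa>' k w)) x y"
    using w * k z by (auto simp: splits_def adj_f hedge_def)
  moreover have "prev_level x (f (El \<kappa>' k w))"
    using * w z k by (auto simp: prev_level_el adj_f)
  moreover have "elem (f (El \<kappa>' k w))"
    using w z by (auto simp: elem_iff)
  ultimately show ?case
    using el_V[OF z(3) w(1)] by blast
next
  case (10 x y)
  then obtain i z i' z' where *: "i \<le> j" "z < lsize i" "x = f (El True i z)" "i' \<le> j" "z' < lsize i'" "y = f (El False i' z')"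
    unfolding mem_S0 mem_S1 by blast
  with 10 have i: "i' = i" "i < j"
    by (auto simp: same_level_els has_next_el)
  \<comment> \<open>The common child of A element \<open>z\<close> and B element \<open>z'\<close>
    has low digit \<open>z\<close> and high digit \<open>z'\<close>.\<close>
  define w where "w = z' * lsize i + z"
  have w: "w mod lsize i = z" "w div lsize i = z'" 
    using * i by (auto simp: w_def)
  have "w < (z' + 1) * lsize i"
    using * by (simp add: w_def)
  also have "\<dots> \<le> lsize i * lsize i"
    using * i by (intro mult_le_mono1) simp
  finally have w': "w < lsize (Suc i)"
    by (simp only: lsize_Suc)
  have "parent (f (El \<kappa> (Suc i) w)) x \<and> parent (f (El \<kappa> (Suc i) w)) y" for \<kappa>
    using w w' * i by (simp add: parent_el del: power_Suc)
  moreover have "Suc i \<le> j"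
    using i by simp
  ultimately show ?case
    using el_V[OF _ w', of True] el_V[OF _ w', of False] mem_S0_el[OF _ w', of True] mem_S1_el[OF _ w', of False]
    by meson
next
  case (11 x y)
  then obtain i z i' z' where *: "i \<le> j" "z < lsize i" "x = f (El False i z)" "i' \<le> j" "z' < lsize i'" "y = f (El False i' z')"
    unfolding mem_S1 by blast
  with 11 have i: "i' = i"
    by (auto simp: same_level_els)
  then show ?case
    using * 11 by (auto simp: adj_f hedge_def)
next
  case (12 x y w)
  then obtain p q \<kappa>' i1 z1 i2 z2 where *: "p < lsize j" "q < lsize j" "x = c p q"
      "i1 \<le> j" "z1 < lsize i1" "y = f (El \<kappa>' i1 z1)" "i2 \<le> j" "z2 < lsize i2" "w = f (El \<kappa>' i2 z2)"
    unfolding same_kind_iff mem_S2 by blast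
  with 12 have "i1 = j" "i2 = j"
    by (auto simp: top_el)
  with 12 * show ?case
    by (auto simp: adj_c)
next
  case (13 x y)
  then obtain p q p' q' where *: "p < lsize j" "q < lsize j" "x = c p q" "p' < lsize j" "q' < lsize j" "y = c p' q'"
    unfolding mem_S2 by blast
  with 13 have "p \<noteq> p' \<or> q \<noteq> q'"
    by blast
  then obtain \<kappa> w where w: "w < lsize j" "(w = (if \<kappa> then p else q)) \<noteq> (w = (if \<kappa> then p' else q'))"
    using * by (metis (full_types))
  have "adj x (f (El \<kappa> j w)) \<noteq> adj y (f (El \<kappa> j w))"
    using w * by (auto simp: adj_c)
  then have "splits (f (El \<kappa> j w)) x y"
    using adj_commute unfolding splits_def by blast
  moreover have "top (f (El \<kappa> j w))" "elem (f (El \<kappa> j w))"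
    using w by (auto simp: top_el elem_iff)
  ultimately show ?case
    using el_V[OF order_refl w(1)] by blast
next
  case (14 x y)
  then show ?case
    by (intro same_bits_split)
next
  case 15
  \<comment> \<open>Together with \<open>0 < j\<close>, which rules out the bottom colour, this
    leaves the top token with neither mark.\<close>
  have "j mod 3 = 0"
    using j by simp
  then show ?case
    using f_V[of "Token j"] j by (auto simp: mem_S12 S_token pbit_def qbit_def intro!: bexI[of _ "f (Token j)"])
next
  case (16 t t')
  then show ?case
    by (simp add: mem_S12)
qed

end

lemma tower_model_imp_emso1:
  assumes "tower_model {1..n} E j f c code"
  shows "emso_models n E emso1"
proof -
  interpret tower_model "{1..n}" E j f c code
    by (rule assms)
  have "X \<subseteq> {1..n}"
    using f_V c_V unfolding X_def hverts_def by blast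
  moreover have "\<forall>k<7. u k \<in> {1..n}"
    using f_V[of "Name _"] f_V[of "Token j"] by (simp add: u_def)
  ultimately show ?thesis
    using is_tower unfolding emso1_models_iff by (intro exI[of _ X] exI[of _ u]) simp
qed

section \<open>Random subsets\<close>

text \<open>Expectation over a random subset of \<open>A\<close> that contains each element
  independently with probability \<open>p\<close>.\<close>

definition expct :: "real \<Rightarrow> 'a set \<Rightarrow> ('a set \<Rightarrow> real) \<Rightarrow> real" where
  "expct p A f = (\<Sum>E\<in>Pow A. p ^ card E * (1 - p) ^ card (A - E) * f E)"

lemma finite_all_pairs: "finite (all_pairs n)"
  by (rule finite_subset[of _ "Pow {1..n}"]) (auto simp: all_pairs_def)

lemma prob_Gnp_expct: "prob_Gnp n p \<psi> = expct p (all_pairs n) (\<lambda>E. of_bool (emso_models n E \<psi>))"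
  unfolding prob_Gnp_def expct_def
  by (intro sum.cong refl) (auto simp: card_Diff_subset finite_subset[OF _ finite_all_pairs])

lemma expct_cong: "(\<And>E. E \<subseteq> A \<Longrightarrow> f E = g E) \<Longrightarrow> expct p A f = expct p A g"
  unfolding expct_def by (intro sum.cong refl) auto

lemma expct_mono:
  assumes "0 \<le> p" "p \<le> 1" "\<And>E. E \<subseteq> A \<Longrightarrow> f E \<le> g E"
  shows "expct p A f \<le> expct p A g"
  unfolding expct_def using assms by (intro sum_mono mult_left_mono) auto

lemma expct_add: "expct p A (\<lambda>E. f E + g E) = expct p A f + expct p A g"
  by (simp add: expct_def sum.distrib distrib_left)

lemma expct_cmult: "expct p A (\<lambda>E. c * f E) = c * expct p A f"
  by (simp add: expct_def sum_distrib_left mult_ac)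

lemma expct_sum: "expct p A (\<lambda>E. \<Sum>i\<in>I. f i E) = (\<Sum>i\<in>I. expct p A (f i))"
  unfolding expct_def sum_distrib_left by (rule sum.swap)

text \<open>Independence: subsets of a disjoint union are pairs of subsets, and the weight
  factorises.\<close>

lemma expct_Un:
  assumes "finite A" "finite B" "A \<inter> B = {}"
  shows "expct p (A \<union> B) (\<lambda>E. f (E \<inter> A) * g (E \<inter> B)) = expct p A f * expct p B g"
proof -
  let ?w = "\<lambda>A E. p ^ card E * (1 - p) ^ card (A - E)"
  have bij: "bij_betw (\<lambda>(F, G). F \<union> G) (Pow A \<times> Pow B) (Pow (A \<union> B))"
    by (rule bij_betw_byWitness[where f' = "\<lambda>E. (E \<inter> A, E \<inter> B)"]) (use assms(3) in auto)
  have "expct p (A \<union> B) (\<lambda>E. f (E \<inter> A) * g (E \<inter> B)) =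
      (\<Sum>(F, G)\<in>Pow A \<times> Pow B. ?w (A \<union> B) (F \<union> G) * (f ((F \<union> G) \<inter> A) * g ((F \<union> G) \<inter> B)))"
    unfolding expct_def by (subst sum.reindex_bij_betw[OF bij, symmetric]) (simp add: case_prod_unfold)
  also have "\<dots> = (\<Sum>(F, G)\<in>Pow A \<times> Pow B. (?w A F * f F) * (?w B G * g G))"
  proof (rule sum.cong[OF refl], clarify)
    fix F G assume FG: "F \<subseteq> A" "G \<subseteq> B"
    have "(F \<union> G) \<inter> A = F" "(F \<union> G) \<inter> B = G" "A \<union> B - (F \<union> G) = (A - F) \<union> (B - G)"
      using FG assms(3) by auto
    moreover have "card (F \<union> G) = card F + card G"
      using FG assms by (intro card_Un_disjoint) (auto intro: finite_subset)
    moreover have "card ((A - F) \<union> (B - G)) = card (A - F) + card (B - G)"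
      using assms by (intro card_Un_disjoint) auto
    ultimately show "?w (A \<union> B) (F \<union> G) * (f ((F \<union> G) \<inter> A) * g ((F \<union> G) \<inter> B)) =
        (?w A F * f F) * (?w B G * g G)"
      by (simp add: power_add)
  qed
  also have "\<dots> = expct p A f * expct p B g"
    unfolding expct_def sum_product by (simp add: sum.cartesian_product)
  finally show ?thesis .
qed

lemma expct_1: "finite A \<Longrightarrow> expct p A (\<lambda>_. 1) = 1"
proof (induction A rule: finite_induct)
  case (insert a A)
  have "expct p ({a} \<union> A) (\<lambda>E. 1 * 1) = expct p {a} (\<lambda>_. 1) * expct p A (\<lambda>_. 1)"
    using insert by (intro expct_Un[of "{a}" A p "\<lambda>_. 1" "\<lambda>_. 1"]) auto
  then show ?case
    using insert.IH by (simp add: expct_def Pow_insert)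
qed (simp add: expct_def)

text \<open>What lies outside \<open>B\<close> is independent and contributes total weight
  1.\<close>

lemma expct_Int:
  assumes "finite A" "B \<subseteq> A"
  shows "expct p A (\<lambda>E. f (E \<inter> B)) = expct p B f"
proof -
  have "expct p (B \<union> (A - B)) (\<lambda>E. f (E \<inter> B) * 1) = expct p B f * expct p (A - B) (\<lambda>_. 1)"
    using assms by (intro expct_Un[of B "A - B" p f "\<lambda>_. 1"]) (auto intro: finite_subset)
  moreover have "B \<union> (A - B) = A"
    using assms by auto
  ultimately show ?thesis
    using assms by (simp add: expct_1)
qed

lemma expct_eq: "finite A \<Longrightarrow> S \<subseteq> A \<Longrightarrow> expct p A (\<lambda>E. of_bool (E = S)) = p ^ card S * (1 - p) ^ card (A - S)"
  by (simp add: expct_def of_bool_def if_distrib sum.If_cases Int_absorb1)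

lemma expct_UN:
  assumes "finite D" "\<And>c. c \<in> D \<Longrightarrow> finite (A c)" "\<And>c d. c \<in> D \<Longrightarrow> d \<in> D \<Longrightarrow> c \<noteq> d \<Longrightarrow> A c \<inter> A d = {}"
  shows "expct p (\<Union>c\<in>D. A c) (\<lambda>E. \<Prod>c\<in>D. f c (E \<inter> A c)) = (\<Prod>c\<in>D. expct p (A c) (f c))"
  using assms
proof (induction D rule: finite_induct)
  case (insert d D)
  have "expct p (A d \<union> (\<Union>c\<in>D. A c)) (\<lambda>E. f d (E \<inter> A d) * (\<Prod>c\<in>D. f c (E \<inter> (\<Union>c\<in>D. A c) \<inter> A c))) =
      expct p (A d) (f d) * expct p (\<Union>c\<in>D. A c) (\<lambda>E. \<Prod>c\<in>D. f c (E \<inter> A c))"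
    using insert.prems insert.hyps
    by (intro expct_Un[of "A d" "\<Union>c\<in>D. A c" p "f d" "\<lambda>E. \<Prod>c\<in>D. f c (E \<inter> A c)"]) auto
  moreover have "(\<Prod>c\<in>D. f c (E \<inter> (\<Union>c\<in>D. A c) \<inter> A c)) = (\<Prod>c\<in>D. f c (E \<inter> A c))" for E
    by (intro prod.cong refl arg_cong[where f = "f _"]) auto
  ultimately show ?case
    using insert by simp
qed (simp add: expct_def)

lemma expct_image:
  assumes "inj_on h W"
  shows "expct p (h ` W) f = expct p W (\<lambda>S. f (h ` S))"
proof -
  have "bij_betw ((`) h) (Pow W) (Pow (h ` W))"
    using assms by (rule bij_betw_Pow[OF inj_on_imp_bij_betw])
  then have "expct p (h ` W) f = (\<Sum>S\<in>Pow W. p ^ card (h ` S) * (1 - p) ^ card (h ` W - h ` S) * f (h ` S))"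
    unfolding expct_def by (rule sum.reindex_bij_betw[symmetric])
  also have "\<dots> = expct p W (\<lambda>S. f (h ` S))"
    unfolding expct_def
  proof (intro sum.cong refl)
    fix S assume S: "S \<in> Pow W"
    then have "h ` W - h ` S = h ` (W - S)" "inj_on h S" "inj_on h (W - S)"
      using assms by (auto simp: inj_on_def)
    then show "p ^ card (h ` S) * (1 - p) ^ card (h ` W - h ` S) * f (h ` S) =
        p ^ card S * (1 - p) ^ card (W - S) * f (h ` S)"
      by (simp add: card_image)
  qed
  finally show ?thesis .
qed

section \<open>Random graphs\<close>

lemma mem_all_pairs: "{x, y} \<in> all_pairs n \<longleftrightarrow> x \<noteq> y \<and> x \<in> {1..n} \<and> y \<in> {1..n}"
  by (auto simp: all_pairs_def doubleton_eq_iff) (metis linorder_neqE_nat)+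

text \<open>As \<open>D\<close> and \<open>W\<close> are disjoint, different centres
  \<open>c\<close> use disjoint sets of pairs, so their neighbourhoods in \<open>W\<close> are
  independent random subsets of \<open>W\<close>.\<close>

lemma expct_stars:
  fixes f :: "nat set \<Rightarrow> real"
  assumes "D \<subseteq> {1..n}" "W \<subseteq> {1..n}" "D \<inter> W = {}"
  shows "expct p (all_pairs n) (\<lambda>E. \<Prod>c\<in>D. f {w \<in> W. {c, w} \<in> E}) = expct p W f ^ card D"
proof -
  define A where "A c = (\<lambda>w. {c, w}) ` W" for c
  have fin: "finite W" "finite D"
    using assms finite_subset by blast+
  have inj: "inj_on (\<lambda>w. {c, w}) W" for c
    by (auto simp: inj_on_def doubleton_eq_iff)
  have sub: "(\<Union>c\<in>D. A c) \<subseteq> all_pairs n"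
    using assms by (force simp: A_def mem_all_pairs)
  have "expct p (all_pairs n) (\<lambda>E. \<Prod>c\<in>D. f {w \<in> W. {c, w} \<in> E}) =
      expct p (all_pairs n) (\<lambda>E. \<Prod>c\<in>D. f {w \<in> W. {c, w} \<in> (E \<inter> (\<Union>c\<in>D. A c)) \<inter> A c})"
    by (intro expct_cong prod.cong refl arg_cong[where f = f]) (auto simp: A_def)
  also have "\<dots> = expct p (\<Union>c\<in>D. A c) (\<lambda>E. \<Prod>c\<in>D. f {w \<in> W. {c, w} \<in> E \<inter> A c})"
    by (rule expct_Int[OF finite_all_pairs sub])
  also have "\<dots> = (\<Prod>c\<in>D. expct p (A c) (\<lambda>E. f {w \<in> W. {c, w} \<in> E}))"
  proof (rule expct_UN[of D A p "\<lambda>c E. f {w \<in> W. {c, w} \<in> E}"])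
    fix c d assume "c \<in> D" "d \<in> D" "c \<noteq> d"
    then show "A c \<inter> A d = {}"
      using assms by (auto simp: A_def doubleton_eq_iff)
  qed (use fin in \<open>auto simp: A_def\<close>)
  also have "\<dots> = (\<Prod>c\<in>D. expct p W f)"
  proof (intro prod.cong refl)
    fix c
    have "expct p (A c) (\<lambda>E. f {w \<in> W. {c, w} \<in> E}) = expct p W (\<lambda>S. f {w \<in> W. {c, w} \<in> (\<lambda>w. {c, w}) ` S})"
      unfolding A_def by (rule expct_image[OF inj])
    also have "\<dots> = expct p W f"
      by (intro expct_cong arg_cong[where f = f]) (use inj in \<open>auto simp: inj_on_def doubleton_eq_iff\<close>)
    finally show "expct p (A c) (\<lambda>E. f {w \<in> W. {c, w} \<in> E}) = expct p W f" .
  qed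
  finally show ?thesis
    by simp
qed

section \<open>First moment bound for cliques\<close>

definition is_clique :: "nat set set \<Rightarrow> nat set \<Rightarrow> bool" where
  "is_clique E K \<longleftrightarrow> (\<forall>x\<in>K. \<forall>y\<in>K. x \<noteq> y \<longrightarrow> {x, y} \<in> E)"

text \<open>Such a set lists as a word of length \<open>k\<close> over \<open>{0..n}\<close>, padded
  with 0, which is not a vertex.\<close>

lemma card_subsets_le:
  "card {K. K \<subseteq> {1..n} \<and> card K \<le> k} \<le> (n + 1) ^ k" "finite {K. K \<subseteq> {1..n} \<and> card K \<le> k}"
proof -
  let ?L = "{xs. set xs \<subseteq> {0..n} \<and> length xs = k}"
  have "{K. K \<subseteq> {1..n} \<and> card K \<le> k} \<subseteq> (\<lambda>xs. set xs - {0}) ` ?L"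
  proof clarify
    fix K :: "nat set" assume K: "K \<subseteq> {1..n}" "card K \<le> k"
    then obtain xs where xs: "set xs = K" "length xs = card K"
      using finite_subset[OF K(1)] finite_distinct_list[of K] distinct_card by (metis finite_atLeastAtMost)
    have "K = set (xs @ replicate (k - card K) 0) - {0}" "xs @ replicate (k - card K) 0 \<in> ?L"
      using K xs by auto
    then show "K \<in> (\<lambda>xs. set xs - {0}) ` ?L"
      by blast
  qed
  then have "card {K. K \<subseteq> {1..n} \<and> card K \<le> k} \<le> card ?L"
    by (rule surj_card_le[OF finite_lists_length_eq[OF finite_atLeastAtMost]])
  then show "card {K. K \<subseteq> {1..n} \<and> card K \<le> k} \<le> (n + 1) ^ k"
    by (simp add: card_lists_length_eq)
  show "finite {K. K \<subseteq> {1..n} \<and> card K \<le> k}"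
    by (rule finite_subset[of _ "Pow {1..n}"]) auto
qed

text \<open>Union bound over all sets of \<open>k\<close> vertices.\<close>

lemma clique_prob:
  assumes "0 < p" "p < 1"
  shows "expct p (all_pairs n) (\<lambda>E. of_bool (\<exists>K\<subseteq>{1..n}. card K = k \<and> is_clique E K)) \<le>
    real ((n + 1) ^ k) * p ^ (k choose 2)"
proof -
  let ?I = "{K. K \<subseteq> {1..n} \<and> card K = k}"
  have finI: "finite ?I"
    by (rule finite_subset[of _ "Pow {1..n}"]) auto
  have single: "expct p (all_pairs n) (\<lambda>E. of_bool (is_clique E K)) = p ^ (k choose 2)" if K: "K \<in> ?I" for K
  proof -
    define B where "B = {P. P \<subseteq> K \<and> card P = 2}"
    have finK: "finite K"
      using K finite_subset by auto
    have B_iff: "P \<in> B \<longleftrightarrow> (\<exists>x\<in>K. \<exists>y\<in>K. x \<noteq> y \<and> P = {x, y})" for P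
      unfolding B_def card_2_iff by auto
    have sub: "B \<subseteq> all_pairs n"
      using K by (auto simp: B_iff mem_all_pairs subset_iff)
    have "is_clique E K \<longleftrightarrow> E \<inter> B = B" for E
      unfolding is_clique_def using B_iff by auto
    then have "expct p (all_pairs n) (\<lambda>E. of_bool (is_clique E K)) =
        expct p (all_pairs n) (\<lambda>E. of_bool (E \<inter> B = B))"
      by simp
    also have "\<dots> = expct p B (\<lambda>E. of_bool (E = B))"
      by (rule expct_Int[OF finite_all_pairs sub])
    also have "\<dots> = p ^ card B"
      using expct_eq[of B B p] finite_subset[OF sub finite_all_pairs] by simp
    also have "card B = k choose 2"
      unfolding B_def using n_subsets[OF finK, of 2] K by simp
    finally show ?thesis .
  qed
  have "expct p (all_pairs n) (\<lambda>E. of_bool (\<exists>K\<subseteq>{1..n}. card K = k \<and> is_clique E K)) \<le>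
      expct p (all_pairs n) (\<lambda>E. \<Sum>K\<in>?I. of_bool (is_clique E K))"
  proof (intro expct_mono)
    fix E
    show "of_bool (\<exists>K\<subseteq>{1..n}. card K = k \<and> is_clique E K) \<le> (\<Sum>K\<in>?I. of_bool (is_clique E K) :: real)"
    proof (cases "\<exists>K\<subseteq>{1..n}. card K = k \<and> is_clique E K")
      case True
      then obtain K where K: "K \<in> ?I" "is_clique E K"
        by auto
      then have "(of_bool (is_clique E K) :: real) \<le> (\<Sum>K\<in>?I. of_bool (is_clique E K))"
        by (intro member_le_sum finI) auto
      then show ?thesis
        using K True by simp
    qed (simp add: sum_nonneg)
  qed (use assms in auto)
  also have "\<dots> = (\<Sum>K\<in>?I. p ^ (k choose 2))"
    unfolding expct_sum by (intro sum.cong refl single)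
  also have "\<dots> = real (card ?I) * p ^ (k choose 2)"
    by simp
  also have "\<dots> \<le> real ((n + 1) ^ k) * p ^ (k choose 2)"
  proof (intro mult_right_mono)
    have "card ?I \<le> card {K. K \<subseteq> {1..n} \<and> card K \<le> k}"
      by (intro card_mono card_subsets_le(2)) auto
    then show "real (card ?I) \<le> real ((n + 1) ^ k)"
      using card_subsets_le(1)[of n k] by linarith
  qed (use assms in auto)
  finally show ?thesis .
qed

text \<open>\<open>2 * p * (1 - p)\<close> is the probability that a vertex is joined to exactly one
  of two others.\<close>

lemma disagree_prob_bounds:
  fixes p :: real
  assumes "0 < p" "p < 1"
  shows "0 < 2 * p * (1 - p)" "2 * p * (1 - p) \<le> 1"
proof -
  show "0 < 2 * p * (1 - p)"
    using assms by simp
  have "0 \<le> (2 * p - 1)\<^sup>2"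
    by simp
  then show "2 * p * (1 - p) \<le> 1"
    by (simp add: power2_eq_square algebra_simps)
qed

section \<open>Candidates that separate a pair\<close>

definition cand :: "nat \<Rightarrow> nat set set \<Rightarrow> nat set \<Rightarrow> nat set \<Rightarrow> nat set" where
  "cand n E W S = {c \<in> {1..n} - W. {w \<in> W. {c, w} \<in> E} = S}"

text \<open>\<open>x\<close> and \<open>y\<close> count neither here nor in \<open>nonsep\<close>,
  so that different \<open>c\<close> involve different vertex pairs and are independent.\<close>

definition sep :: "nat set set \<Rightarrow> nat \<Rightarrow> nat \<Rightarrow> nat \<Rightarrow> bool" where
  "sep E x y c \<longleftrightarrow> c \<noteq> x \<and> c \<noteq> y \<and> ({c, x} \<in> E \<longleftrightarrow> {c, y} \<notin> E)"

definition nonsep :: "nat set set \<Rightarrow> nat \<Rightarrow> nat \<Rightarrow> nat \<Rightarrow> bool" where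
  "nonsep E x y c \<longleftrightarrow> c \<noteq> x \<and> c \<noteq> y \<and> ({c, x} \<in> E \<longleftrightarrow> {c, y} \<in> E)"

text \<open>A bound on the number of separating candidates by a multiple of the non-separating ones,
  free of logarithms. The added 2 accounts for \<open>x\<close> and \<open>y\<close>, which may be
  candidates too.\<close>

definition few_sep :: "nat \<Rightarrow> real \<Rightarrow> nat set set \<Rightarrow> nat set \<Rightarrow> nat set \<Rightarrow> nat \<Rightarrow> nat \<Rightarrow> bool" where
  "few_sep n v E W S x y \<longleftrightarrow>
     2 ^ card {c \<in> cand n E W S. sep E x y c} \<le> v ^ (card {c \<in> cand n E W S. nonsep E x y c} + 2)"

text \<open>
  Markov's inequality for a product of independent factors, one for each candidate: \<open>v\<close> if it
  does not separate \<open>x\<close> and \<open>y\<close>, \<open>1 / 2\<close> if it does. The value of \<open>v\<close> makes the mean of a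
  factor smaller than 1.
\<close>

lemma few_sep_prob:
  fixes p :: real
  assumes p: "0 < p" "p < 1" and W: "W \<subseteq> {1..n}" "S \<subseteq> W" and xy: "x \<in> {1..n} - W" "y \<in> {1..n} - W" "x \<noteq> y"
  defines "s \<equiv> 2 * p * (1 - p)" 
  defines "v \<equiv> 1 + s / 4"
  shows "expct p (all_pairs n) (\<lambda>E. of_bool (few_sep n v E W S x y)) \<le>
    v\<^sup>2 * (1 - min p (1 - p) ^ card W * s / 4) ^ (n - card W - 2)"
proof -
  have s: "0 < s" "s \<le> 1"
    unfolding s_def by (rule disagree_prob_bounds[OF p])+
  have v: "1 \<le> v" using s by (simp add: v_def)
  have finW: "finite W" using W finite_subset by blast
  define W' where "W' = W \<union> {x, y}"
  define D where "D = {1..n} - W'"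
  \<comment> \<open>\<open>g\<close> is a candidate's factor minus 1. In this form the mean of
    \<open>f\<close> is 1 plus the product of the probability of being a candidate and the mean of
    \<open>g\<close>, as the two parts of the neighbourhood are independent.\<close>
  define g where "g T = (if T = {x} \<or> T = {y} then - 1 / 2 else v - 1)" for T
  define f where "f T = 1 + of_bool (T \<inter> W = S) * g (T \<inter> {x, y})" for T
  define \<pi> where "\<pi> = p ^ card S * (1 - p) ^ card (W - S)"
  have le: "of_bool (few_sep n v E W S x y) \<le> v\<^sup>2 * (\<Prod>c\<in>D. f {w \<in> W'. {c, w} \<in> E})" for E
  proof -
    let ?A = "{c \<in> cand n E W S. sep E x y c}" and ?B = "{c \<in> cand n E W S. nonsep E x y c}"
    have f_eq: "f {w \<in> W'. {c, w} \<in> E} = (if c \<in> ?A then 1 / 2 else if c \<in> ?B then v else 1)" if "c \<in> D" for c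
    proof -
      have c: "c \<in> {1..n}" "c \<notin> W" "c \<noteq> x" "c \<noteq> y"
        using that by (auto simp: D_def W'_def)
      have "{w \<in> W'. {c, w} \<in> E} \<inter> W = {w \<in> W. {c, w} \<in> E}"
        by (auto simp: W'_def)
      moreover have "{w \<in> W'. {c, w} \<in> E} \<inter> {x, y} = {w \<in> {x, y}. {c, w} \<in> E}"
        by (auto simp: W'_def)
      moreover have "({w \<in> {x, y}. {c, w} \<in> E} = {x} \<or> {w \<in> {x, y}. {c, w} \<in> E} = {y}) \<longleftrightarrow>
          ({c, x} \<in> E \<longleftrightarrow> {c, y} \<notin> E)"
        using xy(3) by auto
      ultimately show ?thesis
        using c by (auto simp: f_def g_def cand_def sep_def nonsep_def)
    qed
    have sub: "?A \<subseteq> D" "?B \<subseteq> D" "?A \<inter> ?B = {}" "finite D"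
      by (auto simp: cand_def D_def W'_def sep_def nonsep_def)
    have "(\<Prod>c\<in>D. f {w \<in> W'. {c, w} \<in> E}) = (\<Prod>c\<in>D. (if c \<in> ?A then 1 / 2 else 1) * (if c \<in> ?B then v else 1))"
      by (intro prod.cong refl) (use f_eq sub(3) in auto)
    also have "\<dots> = (1 / 2) ^ card ?A * v ^ card ?B"
    proof -
      have "(\<Prod>c\<in>D. if c \<in> ?A then 1 / 2 else 1 :: real) = (1 / 2) ^ card ?A"
        using sub by (subst prod.inter_restrict[symmetric]) (auto simp: Int_absorb1)
      moreover have "(\<Prod>c\<in>D. if c \<in> ?B then v else 1 :: real) = v ^ card ?B"
        using sub by (subst prod.inter_restrict[symmetric]) (auto simp: Int_absorb1)
      ultimately show ?thesis
        by (simp add: prod.distrib)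
    qed
    finally have eq: "v\<^sup>2 * (\<Prod>c\<in>D. f {w \<in> W'. {c, w} \<in> E}) = v ^ (card ?B + 2) / 2 ^ card ?A"
      by (simp add: power_add power_divide power2_eq_square)
    show ?thesis
    proof (cases "few_sep n v E W S x y")
      case True
      then have "1 \<le> v ^ (card ?B + 2) / 2 ^ card ?A"
        unfolding few_sep_def by (subst le_divide_eq_1_pos) auto
      then show ?thesis
        using True unfolding eq by simp
    next
      case False
      then show ?thesis
        using v unfolding eq by simp
    qed
  qed
  have "card D = n - card W'"
    unfolding D_def using W xy finW by (subst card_Diff_subset) (auto simp: W'_def)
  moreover have "card W' = card W + 2"
    using xy finW by (auto simp: W'_def)
  ultimately have cardD: "card D = n - card W - 2"
    by simp
  have pi0: "0 \<le> \<pi>" "\<pi> \<le> 1"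
    using p by (auto simp: \<pi>_def intro!: mult_le_one power_le_one)
  have "expct p W' f = expct p W' (\<lambda>_. 1) + expct p W' (\<lambda>T. of_bool (T \<inter> W = S) * g (T \<inter> {x, y}))"
    unfolding f_def by (rule expct_add)
  also have "expct p W' (\<lambda>T. of_bool (T \<inter> W = S) * g (T \<inter> {x, y})) = expct p W (\<lambda>T. of_bool (T = S)) * expct p {x, y} g"
    unfolding W'_def using finW xy by (intro expct_Un) auto
  also have "expct p W (\<lambda>T. of_bool (T = S)) = \<pi>"
    unfolding \<pi>_def by (rule expct_eq[OF finW W(2)])
  also have "expct p W' (\<lambda>_. 1) = 1"
    using finW by (intro expct_1) (simp add: W'_def)
  also have "expct p {x, y} g = s * (- 1 / 2) + (1 - s) * (v - 1)"
  proof -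
    have Pow: "Pow {x, y} = {{}, {x}, {y}, {x, y}}"
      by auto
    have ne: "{x, y} \<noteq> {x}" "{x, y} \<noteq> {y}" "{x} \<noteq> {y}" "{x, y} - {x} = {y}" "{x, y} - {y} = {x}"
      using xy(3) by auto
    show ?thesis
      unfolding expct_def Pow using xy(3) ne by (simp add: g_def s_def algebra_simps power2_eq_square)
  qed
  finally have fW': "expct p W' f = 1 + \<pi> * (s * (- 1 / 2) + (1 - s) * (v - 1))" .
  \<comment> \<open>As \<open>v - 1 = s / 4\<close>, the gain is at most half of the loss
    \<open>s / 2\<close>.\<close>
  have "s * (- 1 / 2) + (1 - s) * (v - 1) \<le> - (s / 4)"
    using s by (simp add: v_def algebra_simps)
  then have "\<pi> * (s * (- 1 / 2) + (1 - s) * (v - 1)) \<le> \<pi> * - (s / 4)"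
    by (intro mult_left_mono pi0)
  then have upper: "expct p W' f \<le> 1 - \<pi> * (s / 4)"
    unfolding fW' by linarith
  \<comment> \<open>The mean must be nonnegative before its bound can be raised to a power.\<close>
  have "0 \<le> (1 - s) * (v - 1)"
    using s v by (intro mult_nonneg_nonneg) auto
  then have "s * (- 1 / 2) + (1 - s) * (v - 1) \<ge> - 1"
    using s by linarith
  then have "\<pi> * (s * (- 1 / 2) + (1 - s) * (v - 1)) \<ge> \<pi> * (- 1)"
    by (intro mult_left_mono pi0)
  then have lower: "0 \<le> expct p W' f"
    unfolding fW' using pi0 by linarith
  \<comment> \<open>A bound on the candidate probability uniform in the pattern
    \<open>S\<close>.\<close>
  have "min p (1 - p) ^ card W = min p (1 - p) ^ card S * min p (1 - p) ^ card (W - S)"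
    using card_Un_disjoint[of S "W - S"] W finW finite_subset[OF W(2) finW]
    by (simp add: Un_absorb1 flip: power_add)
  also have "\<dots> \<le> \<pi>"
    unfolding \<pi>_def using p by (intro mult_mono power_mono) auto
  finally have "expct p W' f \<le> 1 - min p (1 - p) ^ card W * s / 4"
    using upper s mult_right_mono[of "min p (1 - p) ^ card W" \<pi> "s / 4"] by linarith
  then have pow: "expct p W' f ^ card D \<le> (1 - min p (1 - p) ^ card W * s / 4) ^ (n - card W - 2)"
    unfolding cardD using lower by (intro power_mono) auto
  have "expct p (all_pairs n) (\<lambda>E. of_bool (few_sep n v E W S x y)) \<le>
      expct p (all_pairs n) (\<lambda>E. v\<^sup>2 * (\<Prod>c\<in>D. f {w \<in> W'. {c, w} \<in> E}))"
    using p le by (intro expct_mono) auto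
  also have "\<dots> = v\<^sup>2 * expct p W' f ^ card D"
    unfolding expct_cmult using W xy by (subst expct_stars) (auto simp: D_def W'_def)
  also have "\<dots> \<le> v\<^sup>2 * (1 - min p (1 - p) ^ card W * s / 4) ^ (n - card W - 2)"
    using pow by (intro mult_left_mono) auto
  finally show ?thesis .
qed

text \<open>The extension property behind the embedding: it makes every pattern on few vertices
  realisable, and it lets a fixed share of the realising vertices separate any given pair.\<close>

definition separable :: "nat \<Rightarrow> real \<Rightarrow> nat \<Rightarrow> nat set set \<Rightarrow> bool" where
  "separable n v m E \<longleftrightarrow> (\<forall>W S x y. W \<subseteq> {1..n} \<and> card W \<le> m \<and> S \<subseteq> W \<and>
     x \<in> {1..n} - W \<and> y \<in> {1..n} - W \<and> x \<noteq> y \<longrightarrow> \<not> few_sep n v E W S x y)"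

text \<open>Union bound over at most \<open>(n + 1) ^ (2 * m + 2)\<close> quadruples
  \<open>(W, S, x, y)\<close>; the bound of \<open>few_sep_prob\<close> is weakest at
  \<open>card W = m\<close>.\<close>

lemma separable_prob:
  fixes p :: real
  assumes p: "0 < p" "p < 1"
  defines "s \<equiv> 2 * p * (1 - p)"
  defines "v \<equiv> 1 + s / 4"
  shows "expct p (all_pairs n) (\<lambda>E. of_bool (\<not> separable n v m E)) \<le>
    real ((n + 1) ^ (2 * m + 2)) * (v\<^sup>2 * (1 - min p (1 - p) ^ m * s / 4) ^ (n - m - 2))"
proof -
  let ?F = "{K. K \<subseteq> {1..n} \<and> card K \<le> m}"
  define Idx where "Idx = {(W, S, x, y). W \<subseteq> {1..n} \<and> card W \<le> m \<and> S \<subseteq> W \<and>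
     x \<in> {1..n} - W \<and> y \<in> {1..n} - W \<and> x \<noteq> y}"
  define few where "few E = (\<lambda>(W, S, x, y). few_sep n v E W S x y)" for E
  let ?b = "v\<^sup>2 * (1 - min p (1 - p) ^ m * s / 4) ^ (n - m - 2)"
  have s: "0 < s" "s \<le> 1"
    unfolding s_def by (rule disagree_prob_bounds[OF p])+
  have sub: "Idx \<subseteq> ?F \<times> ?F \<times> {0..n} \<times> {0..n}"
  proof -
    have "card S \<le> m" if "W \<subseteq> {1..n}" "S \<subseteq> W" "card W \<le> m" for W S
      using that card_mono[of W S] finite_subset[of W "{1..n}"] by simp
    then show ?thesis
      unfolding Idx_def by fastforce
  qed
  have finF: "finite (?F \<times> ?F \<times> {0..n} \<times> {0..n})"
    by (intro finite_cartesian_product card_subsets_le(2)) auto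
  then have finIdx: "finite Idx"
    using sub finite_subset by blast
  have "card Idx \<le> card (?F \<times> ?F \<times> {0..n} \<times> {0..n})"
    by (rule card_mono[OF finF sub])
  also have "\<dots> = card ?F * (card ?F * ((n + 1) * (n + 1)))"
    by (simp add: card_cartesian_product)
  also have "\<dots> \<le> (n + 1) ^ m * ((n + 1) ^ m * ((n + 1) * (n + 1)))"
    by (intro mult_le_mono card_subsets_le(1) order_refl)
  also have "\<dots> = (n + 1) ^ (2 * m + 2)"
    by (simp only: power_add mult_2 power2_eq_square mult.assoc)
  finally have cardIdx: "card Idx \<le> (n + 1) ^ (2 * m + 2)" .
  have mu: "0 \<le> min p (1 - p)" "min p (1 - p) \<le> 1"
    using p by auto
  have base: "0 \<le> 1 - min p (1 - p) ^ k * s / 4" "1 - min p (1 - p) ^ k * s / 4 \<le> 1" for k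
    using mult_le_one[of "min p (1 - p) ^ k" s] s mu by (auto simp: power_le_one)
  have b0: "0 \<le> ?b"
    using base(1)[of m] by (intro mult_nonneg_nonneg) auto
  have single: "expct p (all_pairs n) (\<lambda>E. of_bool (few E i)) \<le> ?b" if "i \<in> Idx" for i
  proof -
    obtain W S x y where i: "i = (W, S, x, y)"
      using prod_cases4 by blast
    with that have *: "W \<subseteq> {1..n}" "card W \<le> m" "S \<subseteq> W" "x \<in> {1..n} - W" "y \<in> {1..n} - W" "x \<noteq> y"
      by (auto simp: Idx_def)
    have "expct p (all_pairs n) (\<lambda>E. of_bool (few E i)) \<le> v\<^sup>2 * (1 - min p (1 - p) ^ card W * s / 4) ^ (n - card W - 2)"
      unfolding i few_def prod.case v_def s_def using few_sep_prob[OF p *(1,3-6)] by simp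
    also have "(1 - min p (1 - p) ^ card W * s / 4) ^ (n - card W - 2) \<le> (1 - min p (1 - p) ^ card W * s / 4) ^ (n - m - 2)"
      using base *(2) by (intro power_decreasing) auto
    also have "\<dots> \<le> (1 - min p (1 - p) ^ m * s / 4) ^ (n - m - 2)"
      using base mu s *(2)
      by (intro power_mono diff_left_mono divide_right_mono mult_right_mono power_decreasing) auto
    finally show ?thesis
      by (simp add: mult_left_mono)
  qed
  have "expct p (all_pairs n) (\<lambda>E. of_bool (\<not> separable n v m E)) \<le>
      expct p (all_pairs n) (\<lambda>E. \<Sum>i\<in>Idx. of_bool (few E i))"
  proof (intro expct_mono)
    fix E
    show "of_bool (\<not> separable n v m E) \<le> (\<Sum>i\<in>Idx. of_bool (few E i) :: real)"
    proof (cases "separable n v m E")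
      case False
      then obtain i where i: "i \<in> Idx" "few E i"
        by (auto simp: separable_def Idx_def few_def)
      then have "(of_bool (few E i) :: real) \<le> (\<Sum>i\<in>Idx. of_bool (few E i))"
        by (intro member_le_sum finIdx) auto
      then show ?thesis
        using i False by simp
    qed (simp add: sum_nonneg)
  qed (use p in auto)
  also have "\<dots> \<le> (\<Sum>i\<in>Idx. ?b)"
    unfolding expct_sum by (intro sum_mono single)
  also have "\<dots> = real (card Idx) * ?b"
    by simp
  also have "\<dots> \<le> real ((n + 1) ^ (2 * m + 2)) * ?b"
    using cardIdx by (intro mult_right_mono b0) linarith
  finally show ?thesis .
qed

section \<open>Embedding the tower\<close>

text \<open>With \<open>r = log 2 v\<close>, the share \<open>r / (1 + r)\<close> that the
  separating candidates exceed or attain once they outnumber \<open>r\<close> times all the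
  others.\<close>

definition sep_rate :: "real \<Rightarrow> real" where
  "sep_rate v = log 2 v / (1 + log 2 v)"

lemma sep_rate:
  assumes "1 < v"
  shows "0 < sep_rate v" "sep_rate v < 1"
proof -
  have "0 < log 2 v"
    using assms by simp
  then show "0 < sep_rate v" "sep_rate v < 1"
    by (auto simp: sep_rate_def intro!: divide_pos_pos)
qed

lemma finite_cand: "finite (cand n E W S)"
  by (simp add: cand_def)

text \<open>Taking logarithms, the separating candidates number more than \<open>log 2 v\<close>
  times the non-separating ones plus 2, and every candidate is of one of these two types or is
  \<open>x\<close> or \<open>y\<close>.\<close>

lemma not_few_sep:
  assumes v: "1 < v" and few: "\<not> few_sep n v E W S x y"
  shows "0 < card {c \<in> cand n E W S. sep E x y c}"
    and "sep_rate v * card (cand n E W S) \<le> card {c \<in> cand n E W S. sep E x y c}"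
proof -
  let ?C = "cand n E W S"
  let ?A = "{c \<in> ?C. sep E x y c}" and ?B = "{c \<in> ?C. nonsep E x y c}"
  define r where "r = log 2 v"
  have r: "0 < r"
    using v by (simp add: r_def)
  have lt: "v ^ (card ?B + 2) < 2 ^ card ?A"
    using few by (simp add: few_sep_def not_le)
  moreover have "1 \<le> v ^ (card ?B + 2)"
    using v by (intro one_le_power) simp
  ultimately show "0 < card ?A"
    by (cases "card ?A") auto
  have "log 2 (v ^ (card ?B + 2)) < log 2 (2 ^ card ?A)"
    using lt v by (subst log_less_cancel_iff) auto
  then have "real (card ?B + 2) * r < card ?A"
    using v unfolding r_def by (subst (asm) (1 2) log_nat_power) auto
  then have *: "r * (real (card ?B) + 2) < card ?A"
    by (simp add: mult.commute add.commute)
  have "?C \<subseteq> ?A \<union> ?B \<union> {x, y}"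
    by (auto simp: sep_def nonsep_def)
  then have "card ?C \<le> card (?A \<union> ?B \<union> {x, y})"
    by (intro card_mono) (auto simp: finite_cand)
  also have "\<dots> \<le> card (?A \<union> ?B) + card {x, y}"
    by (rule card_Un_le)
  also have "\<dots> \<le> card ?A + card ?B + 2"
    using card_Un_le[of ?A ?B] card_insert_le_m1[of 2 "{y}" x] by simp
  finally have "r * card ?C \<le> r * (real (card ?A) + real (card ?B) + 2)"
    using r by (intro mult_left_mono) auto
  also have "\<dots> \<le> (1 + r) * card ?A"
    using * by (simp add: algebra_simps)
  finally show "sep_rate v * card ?C \<le> card ?A"
    using r by (simp add: sep_rate_def r_def[symmetric] field_simps)
qed

text \<open>Any two vertices outside \<open>W\<close> have a separating candidate;
  \<open>m + 2 \<le> n\<close> supplies two such vertices.\<close>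

lemma cand_nonempty:
  assumes sep: "separable n v m E" and v: "1 < v" and n: "m + 2 \<le> n"
    and W: "W \<subseteq> {1..n}" "card W \<le> m" "S \<subseteq> W"
  shows "cand n E W S \<noteq> {}"
proof -
  have "card ({1..n} - W) = n - card W"
    using W by (subst card_Diff_subset) (auto intro: finite_subset)
  then have "2 \<le> card ({1..n} - W)"
    using W n by simp
  then obtain T where "T \<subseteq> {1..n} - W" "card T = 2"
    by (metis obtain_subset_with_card_n)
  then obtain x y where xy: "x \<in> {1..n} - W" "y \<in> {1..n} - W" "x \<noteq> y"
    by (auto simp: card_2_iff)
  then have "0 < card {c \<in> cand n E W S. sep E x y c}"
    using not_few_sep(1)[OF v] sep W unfolding separable_def by blast
  then show ?thesis
    by (auto simp: card_gt_0_iff)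
qed

text \<open>Greedy embedding: each new vertex is a candidate with the required pattern on the image
  so far.\<close>

lemma embed:
  assumes sep: "separable n v m E" and v: "1 < v" and n: "m + 2 \<le> n" and E: "E \<subseteq> all_pairs n"
    and sym: "\<And>h h'. R h h' \<longleftrightarrow> R h' h" and irrefl: "\<And>h. \<not> R h h"
    and H: "finite H" "card H \<le> m"
  shows "\<exists>f. inj_on f H \<and> f ` H \<subseteq> {1..n} \<and> (\<forall>h\<in>H. \<forall>h'\<in>H. {f h, f h'} \<in> E \<longleftrightarrow> R h h')"
  using H
proof (induction H rule: finite_induct)
  case (insert a H)
  then obtain f where f: "inj_on f H" "f ` H \<subseteq> {1..n}" "\<forall>h\<in>H. \<forall>h'\<in>H. {f h, f h'} \<in> E \<longleftrightarrow> R h h'"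
    by auto
  have "card (f ` H) \<le> m"
    using insert f by (simp add: card_image)
  then have "cand n E (f ` H) (f ` {h \<in> H. R a h}) \<noteq> {}"
    using f by (intro cand_nonempty[OF sep v n]) auto
  then obtain c where c: "c \<in> {1..n} - f ` H" "{w \<in> f ` H. {c, w} \<in> E} = f ` {h \<in> H. R a h}"
    by (auto simp: cand_def)
  have ch: "{c, f h} \<in> E \<longleftrightarrow> R a h" if "h \<in> H" for h
    using c(2) f(1) that by (auto simp: inj_on_def set_eq_iff)
  \<comment> \<open>\<open>{c, c}\<close> is a singleton, not a pair; this matches the irreflexivity
    of \<open>R\<close>.\<close>
  have cc: "{c, c} \<notin> E"
    using E mem_all_pairs[of c c n] by blast
  define g where "g = f(a := c)"
  have g: "g a = c" "\<And>h. h \<in> H \<Longrightarrow> g h = f h"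
    using insert by (auto simp: g_def)
  have "inj_on g (insert a H)"
  proof -
    have "inj_on g H" "g ` H = f ` H"
      using f(1) g(2) by (auto cong: inj_on_cong image_cong)
    then show ?thesis
      using insert.hyps c(1) g(1) by simp
  qed
  moreover have "g ` insert a H \<subseteq> {1..n}"
    using f(2) c(1) g by auto
  moreover have "\<forall>h\<in>insert a H. \<forall>h'\<in>insert a H. {g h, g h'} \<in> E \<longleftrightarrow> R h h'"
  proof (intro ballI)
    fix h h' assume hh: "h \<in> insert a H" "h' \<in> insert a H"
    consider "h \<in> H" "h' \<in> H" | "h = a" "h' \<in> H" | "h \<in> H" "h' = a" | "h = a" "h' = a"
      using hh by blast
    then show "{g h, g h'} \<in> E \<longleftrightarrow> R h h'"
    proof cases
      case 3
      then have "{g h, g h'} = {c, f h}"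
        using g by (simp add: insert_commute)
      then show ?thesis
        using 3 ch sym by metis
    qed (use f(3) ch g cc irrefl in auto)
  qed
  ultimately show ?case
    by blast
qed simp

text \<open>Greedy choice by averaging: each pair not yet separated is separated by a fixed share of
  the candidates, so some candidate separates that share of the remaining pairs, whose number thus
  decays geometrically.\<close>

lemma separating_choice:
  assumes sep: "separable n v m E" and v: "1 < v" and n: "m + 2 \<le> n"
    and W: "W \<subseteq> {1..n}" "card W \<le> m" and I: "finite I" "\<And>i. i \<in> I \<Longrightarrow> S i \<subseteq> W"
  shows "\<exists>c. (\<forall>i\<in>I. c i \<in> cand n E W (S i)) \<and>
    real (card {(x, y). x \<in> {1..n} - W \<and> y \<in> {1..n} - W \<and> x \<noteq> y \<and> (\<forall>i\<in>I. \<not> sep E x y (c i))})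
      \<le> (1 - sep_rate v) ^ card I * real n ^ 2"
  using I
proof (induction I rule: finite_induct)
  case empty
  have "card {(x, y). x \<in> {1..n} - W \<and> y \<in> {1..n} - W \<and> x \<noteq> y} \<le> card ({1..n} \<times> {1..n})"
    by (intro card_mono) auto
  then show ?case
    by (simp add: power2_eq_square flip: of_nat_mult)
next
  case (insert k I)
  then obtain c where c: "\<forall>i\<in>I. c i \<in> cand n E W (S i)"
    "real (card {(x, y). x \<in> {1..n} - W \<and> y \<in> {1..n} - W \<and> x \<noteq> y \<and> (\<forall>i\<in>I. \<not> sep E x y (c i))})
      \<le> (1 - sep_rate v) ^ card I * real n ^ 2"
    by auto
  define U where "U = {(x, y). x \<in> {1..n} - W \<and> y \<in> {1..n} - W \<and> x \<noteq> y \<and> (\<forall>i\<in>I. \<not> sep E x y (c i))}"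
  define C where "C = cand n E W (S k)"
  have finU: "finite U"
    by (rule finite_subset[of _ "{1..n} \<times> {1..n}"]) (auto simp: U_def)
  have C: "finite C" "C \<noteq> {}"
    unfolding C_def using insert.prems by (auto intro!: finite_cand cand_nonempty[OF sep v n W])
  define s where "s a = {(x, y) \<in> U. sep E x y a}" for a
  \<comment> \<open>Double counting of the incidences between remaining pairs and candidates
    separating them.\<close>
  have "sep_rate v * card C * card U = (\<Sum>xy\<in>U. sep_rate v * card C)"
    by simp
  also have "\<dots> \<le> (\<Sum>xy\<in>U. real (card {a \<in> C. sep E (fst xy) (snd xy) a}))"
  proof (rule sum_mono)
    fix xy assume "xy \<in> U"
    then have "\<not> few_sep n v E W (S k) (fst xy) (snd xy)"
      using sep W insert.prems unfolding separable_def U_def by force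
    then show "sep_rate v * card C \<le> card {a \<in> C. sep E (fst xy) (snd xy) a}"
      unfolding C_def by (rule not_few_sep(2)[OF v])
  qed
  also have "\<dots> = (\<Sum>xy\<in>U. \<Sum>a\<in>C. of_bool (sep E (fst xy) (snd xy) a))"
    using C by (simp add: Int_def)
  also have "\<dots> = (\<Sum>a\<in>C. \<Sum>xy\<in>U. of_bool (sep E (fst xy) (snd xy) a))"
    by (rule sum.swap)
  also have "\<dots> = (\<Sum>a\<in>C. real (card (s a)))"
    using finU by (intro sum.cong refl) (simp add: s_def Int_def case_prod_unfold)
  finally have avg: "sep_rate v * card C * card U \<le> (\<Sum>a\<in>C. real (card (s a)))" .
  have "\<exists>a\<in>C. sep_rate v * card U \<le> card (s a)"
  proof (rule ccontr)
    assume "\<not> ?thesis"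
    then have "(\<Sum>a\<in>C. real (card (s a))) < (\<Sum>a\<in>C. sep_rate v * card U)"
      using C by (intro sum_strict_mono) auto
    then show False
      using avg by (simp add: mult_ac)
  qed
  then obtain a where a: "a \<in> C" "sep_rate v * card U \<le> card (s a)"
    by blast
  define c' where "c' = c(k := a)"
  have c': "c' k = a" "\<And>i. i \<in> I \<Longrightarrow> c' i = c i"
    using insert by (auto simp: c'_def)
  have eq: "{(x, y). x \<in> {1..n} - W \<and> y \<in> {1..n} - W \<and> x \<noteq> y \<and> (\<forall>i\<in>insert k I. \<not> sep E x y (c' i))} = U - s a"
    using c' by (auto simp: U_def s_def)
  have "s a \<subseteq> U"
    by (auto simp: s_def)
  then have "real (card (U - s a)) = real (card U) - card (s a)"
    using finU by (simp add: card_Diff_subset finite_subset card_mono of_nat_diff)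
  also have "\<dots> \<le> (1 - sep_rate v) * card U"
    using a by (simp add: algebra_simps)
  also have "\<dots> \<le> (1 - sep_rate v) * ((1 - sep_rate v) ^ card I * real n ^ 2)"
    using c(2) sep_rate[OF v] unfolding U_def by (intro mult_left_mono) auto
  also have "\<dots> = (1 - sep_rate v) ^ card (insert k I) * real n ^ 2"
    using insert.hyps by simp
  finally have "real (card (U - s a)) \<le> (1 - sep_rate v) ^ card (insert k I) * real n ^ 2" .
  moreover have "\<forall>i\<in>insert k I. c' i \<in> cand n E W (S i)"
    using c(1) a c' by (auto simp: C_def)
  ultimately show ?case
    unfolding eq[symmetric] by (intro exI[of _ c'] conjI)
qed

lemma finite_hverts: "finite (hverts j)" and finite_lower: "finite (lower j)"
  by (auto simp: hverts_def lower_def tokens_def els_def)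

lemma card_lower:
  assumes "0 < j"
  shows "card (lower j) \<le> j + 1 + 2 * j * lsize (j - 1)"
proof -
  have "card (\<Union>i\<in>{..<j}. \<Union>\<kappa>\<in>UNIV. El \<kappa> i ` {..<lsize i}) \<le> (\<Sum>i\<in>{..<j}. card (\<Union>\<kappa>\<in>UNIV. El \<kappa> i ` {..<lsize i}))"
    by (rule card_UN_le) simp
  also have "\<dots> \<le> (\<Sum>i\<in>{..<j}. 2 * lsize (j - 1))"
  proof (rule sum_mono)
    fix i assume i: "i \<in> {..<j}"
    have "card (\<Union>\<kappa>\<in>UNIV. El \<kappa> i ` {..<lsize i}) \<le> (\<Sum>\<kappa>\<in>UNIV. card (El \<kappa> i ` {..<lsize i}))"
      by (rule card_UN_le) simp
    also have "\<dots> \<le> (\<Sum>\<kappa>\<in>(UNIV :: bool set). lsize i)"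
      by (intro sum_mono order_trans[OF card_image_le]) auto
    also have "\<dots> = 2 * lsize i"
      by simp
    also have "lsize i \<le> lsize (j - 1)"
      using i by (intro power_increasing) auto
    finally show "card (\<Union>\<kappa>\<in>UNIV. El \<kappa> i ` {..<lsize i}) \<le> 2 * lsize (j - 1)"
      by simp
  qed
  also have "\<dots> = 2 * j * lsize (j - 1)"
    by simp
  finally have "card (\<Union>i\<in>{..<j}. \<Union>\<kappa>\<in>UNIV. El \<kappa> i ` {..<lsize i}) \<le> 2 * j * lsize (j - 1)" .
  moreover have "card (tokens j) \<le> j + 1"
    unfolding tokens_def using card_image_le[of "{..j}" Token] by simp
  ultimately show ?thesis
    unfolding lower_def by (intro order_trans[OF card_Un_le]) linarith
qed

lemma card_hverts: "card (hverts j) \<le> 6 + card (lower j) + 2 * lsize j"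
proof -
  have "hverts j \<subseteq> Name ` {..<6} \<union> lower j \<union> (\<Union>\<kappa>\<in>UNIV. El \<kappa> j ` {..<lsize j})"
  proof
    fix h assume "h \<in> hverts j"
    then show "h \<in> Name ` {..<6} \<union> lower j \<union> (\<Union>\<kappa>\<in>UNIV. El \<kappa> j ` {..<lsize j})"
      by (cases h) (auto simp: image_iff)
  qed
  then have "card (hverts j) \<le> card (Name ` {..<6} \<union> lower j \<union> (\<Union>\<kappa>\<in>UNIV. El \<kappa> j ` {..<lsize j}))"
    by (intro card_mono) (auto simp: finite_lower)
  also have "\<dots> \<le> card (Name ` {..<6}) + card (lower j) + card (\<Union>\<kappa>\<in>UNIV. El \<kappa> j ` {..<lsize j})"
    by (intro order_trans[OF card_Un_le] add_mono card_Un_le order_refl)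
  also have "card (Name ` {..<6}) \<le> 6"
    using card_image_le[of "{..<6::nat}" Name] by simp
  also have "card (\<Union>\<kappa>\<in>UNIV. El \<kappa> j ` {..<lsize j}) \<le> (\<Sum>\<kappa>\<in>UNIV. card (El \<kappa> j ` {..<lsize j}))"
    by (rule card_UN_le) simp
  also have "\<dots> \<le> (\<Sum>\<kappa>\<in>(UNIV :: bool set). lsize j)"
    by (intro sum_mono order_trans[OF card_image_le]) auto
  also have "\<dots> = 2 * lsize j"
    by simp
  finally show ?thesis
    by simp
qed

text \<open>Embed the tower, then choose the separating vertices with the patterns
  \<open>cpat\<close>. The hypothesis \<open>small\<close> says that fewer than one pair stays
  unseparated.\<close>

lemma separable_imp_emso1:
  assumes sep: "separable n v m E" and v: "1 < v" and n: "m + 2 \<le> n" and E: "E \<subseteq> all_pairs n"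
    and j: "3 dvd j" "0 < j" and lower: "card (lower j) \<le> lsize j" and H: "card (hverts j) \<le> m"
    and small: "(1 - sep_rate v) ^ (lsize j * lsize j) * real n ^ 2 < 1"
  shows "emso_models n E emso1"
proof -
  have "\<exists>f. inj_on f (hverts j) \<and> f ` hverts j \<subseteq> {1..n} \<and>
      (\<forall>h\<in>hverts j. \<forall>h'\<in>hverts j. {f h, f h'} \<in> E \<longleftrightarrow> hedge h h')"
  proof (rule embed[OF sep v n E _ _ finite_hverts H])
    show "\<not> hedge h h" for h
      by (cases h) (auto simp: hedge_def)
  qed (auto simp: hedge_def)
  then obtain f where f: "inj_on f (hverts j)" "f ` hverts j \<subseteq> {1..n}"
      "\<forall>h\<in>hverts j. \<forall>h'\<in>hverts j. {f h, f h'} \<in> E \<longleftrightarrow> hedge h h'"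
    by blast
  obtain code where code: "inj_on code (lower j)" "code ` lower j \<subseteq> {..<lsize j}"
    using card_le_inj[OF finite_lower finite_lessThan, of j "lsize j"] lower by auto
  define W where "W = f ` hverts j"
  define I where "I = {..<lsize j} \<times> {..<lsize j}"
  define P where "P = (\<lambda>(p, q). f ` {h \<in> hverts j. cpat j code p q h})"
  have W: "W \<subseteq> {1..n}" "card W \<le> m"
    unfolding W_def using f H by (auto simp: card_image)
  have "\<exists>c. (\<forall>i\<in>I. c i \<in> cand n E W (P i)) \<and>
    real (card {(x, y). x \<in> {1..n} - W \<and> y \<in> {1..n} - W \<and> x \<noteq> y \<and> (\<forall>i\<in>I. \<not> sep E x y (c i))})
      \<le> (1 - sep_rate v) ^ card I * real n ^ 2"
    by (rule separating_choice[OF sep v n W]) (auto simp: I_def P_def W_def)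
  then obtain c where c: "\<forall>i\<in>I. c i \<in> cand n E W (P i)"
    and unsep: "real (card {(x, y). x \<in> {1..n} - W \<and> y \<in> {1..n} - W \<and> x \<noteq> y \<and> (\<forall>i\<in>I. \<not> sep E x y (c i))})
      \<le> (1 - sep_rate v) ^ card I * real n ^ 2"
    by blast
  define Z where "Z = {(x, y). x \<in> {1..n} - W \<and> y \<in> {1..n} - W \<and> x \<noteq> y \<and> (\<forall>i\<in>I. \<not> sep E x y (c i))}"
  have "card I = lsize j * lsize j"
    by (simp add: I_def card_cartesian_product)
  then have "real (card Z) < 1"
    using unsep small unfolding Z_def by simp
  moreover have "finite Z"
    by (rule finite_subset[of _ "{1..n} \<times> {1..n}"]) (auto simp: Z_def)
  ultimately have Z: "Z = {}"
    by simp
  have "tower_model {1..n} E j f (\<lambda>p q. c (p, q)) code"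
  proof
    show "3 dvd j" "0 < j" "inj_on f (hverts j)" "inj_on code (lower j)" "code ` lower j \<subseteq> {..<lsize j}"
      by fact+
    show "f h \<in> {1..n}" if "h \<in> hverts j" for h
      using f that by blast
    show "{f h, f h'} \<in> E \<longleftrightarrow> hedge h h'" if "h \<in> hverts j" "h' \<in> hverts j" for h h'
      using f that by blast
    show "c (p, q) \<in> {1..n} - f ` hverts j" if "p < lsize j" "q < lsize j" for p q
      using c that unfolding I_def W_def cand_def by blast
    show "{c (p, q), f h} \<in> E \<longleftrightarrow> cpat j code p q h" if "p < lsize j" "q < lsize j" "h \<in> hverts j" for p q h
    proof -
      have "{w \<in> W. {c (p, q), w} \<in> E} = P (p, q)"
        using c that unfolding I_def cand_def by blast
      moreover have "f h \<in> W"
        using that by (simp add: W_def)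
      ultimately have "{c (p, q), f h} \<in> E \<longleftrightarrow> f h \<in> P (p, q)"
        by blast
      also have "\<dots> \<longleftrightarrow> cpat j code p q h"
        using f(1) that by (auto simp: P_def inj_on_def)
      finally show ?thesis .
    qed
    show "\<exists>p<lsize j. \<exists>q<lsize j. {c (p, q), x} \<in> E \<longleftrightarrow> {c (p, q), y} \<notin> E"
      if xy: "x \<in> {1..n} - f ` hverts j" "y \<in> {1..n} - f ` hverts j" "x \<noteq> y" for x y
    proof -
      have "(x, y) \<notin> Z"
        using Z by simp
      then obtain i where "i \<in> I" "sep E x y (c i)"
        using xy unfolding Z_def W_def by blast
      then show ?thesis
        by (auto simp: I_def sep_def)
    qed
  qed
  then show ?thesis
    by (rule tower_model_imp_emso1)
qed

section \<open>Oscillation of the probabilities\<close>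

text \<open>With \<open>a = lsize j\<close>, a top level of size at most \<open>a\<close> cannot
  account for \<open>2 ^ (a ^ 4)\<close> vertices. The index of the top is a multiple of 3, so it is
  at least \<open>j + 3\<close>, where the size is \<open>a ^ 8\<close>.\<close>

lemma emso3_imp_clique:
  assumes j: "3 dvd j" "0 < j" and n: "n = 2 ^ (lsize j ^ 4)" and "emso_models n E emso3"
  shows "\<exists>K\<subseteq>{1..n}. card K = lsize j ^ 8 \<and> is_clique E K"
proof -
  obtain S where "tower {1..n} E S"
    using assms unfolding emso3_models_iff by blast
  then have "\<exists>i K. 3 dvd i \<and> card {1..n} \<le> 2 ^ ((2 ^ 2 ^ i + 1)\<^sup>2 + 13) \<and> K \<subseteq> {1..n} \<and> card K = 2 ^ 2 ^ i \<and>
    (\<forall>x\<in>K. \<forall>y\<in>K. x \<noteq> y \<longrightarrow> {x, y} \<in> E)"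
    by (rule tower.tower_bounds) simp
  then obtain i K where i: "3 dvd i" "card {1..n} \<le> 2 ^ ((lsize i + 1)\<^sup>2 + 13)" and K: "K \<subseteq> {1..n}" "card K = lsize i"
    "\<forall>x\<in>K. \<forall>y\<in>K. x \<noteq> y \<longrightarrow> {x, y} \<in> E"
    by (elim exE conjE)
  define a where "a = lsize j"
  have "2 ^ 2 ^ 1 \<le> a"
    unfolding a_def using j by (intro power_increasing) auto
  then have a4: "4 \<le> a"
    by simp
  have "(2::nat) ^ (a ^ 4) \<le> 2 ^ ((lsize i + 1)\<^sup>2 + 13)"
    using i(2) n by (simp add: a_def)
  then have le: "a ^ 4 \<le> (lsize i + 1)\<^sup>2 + 13"
    by (rule power_le_imp_le_exp[rotated]) simp
  have "j < i"
  proof (rule ccontr)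
    assume "\<not> j < i"
    then have "lsize i \<le> a"
      unfolding a_def by (intro power_increasing) auto
    then have "(lsize i + 1)\<^sup>2 \<le> (a + 1)\<^sup>2"
      by (intro power_mono) auto
    \<comment> \<open>\<open>a \<ge> 4\<close>, guaranteed by \<open>0 < j\<close>, makes
      \<open>16 * a\<^sup>2\<close> fit between this and \<open>a ^ 4\<close>.\<close>
    moreover have "(a + 1)\<^sup>2 + 13 < 16 * a\<^sup>2"
    proof -
      have "4 * a \<le> a * a"
        using a4 by (intro mult_le_mono1)
      then have "2 * a + 14 < 15 * (a * a)"
        using a4 by linarith
      then show ?thesis
        by (simp add: power2_eq_square algebra_simps)
    qed
    moreover have "16 * a\<^sup>2 \<le> a ^ 4"
      using mult_le_mono[OF power_mono[OF a4, of 2] order_refl[of "a\<^sup>2"]] by (simp flip: power_add)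
    ultimately show False
      using le by linarith
  qed
  then have "j + 3 \<le> i"
    using i(1) j(1) by (auto elim!: dvdE)
  then have "lsize (j + 3) \<le> lsize i"
    by (intro power_increasing) auto
  moreover have "lsize (j + 3) = a ^ 8"
    by (simp add: a_def power_add flip: power_mult)
  ultimately obtain K' where "K' \<subseteq> K" "card K' = a ^ 8"
    using K(2) by (metis obtain_subset_with_card_n)
  then show ?thesis
    using K(1,3) unfolding a_def is_clique_def by blast
qed

section \<open>Limits of the two error bounds\<close>

lemma exp_ln_power:
  assumes "0 < x"
  shows "exp (ln x * real b ^ k) = x ^ (b ^ k)"
proof -
  have "exp (ln x * real b ^ k) = exp (real (b ^ k) * ln x)"
    by (simp add: mult.commute)
  then show ?thesis
    using assms by (simp only: exp_of_nat_mult exp_ln)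
qed

text \<open>With \<open>k = a ^ 8\<close>, the bound is at most \<open>x a ^ k\<close>, and
  \<open>x a\<close> tends to 0 because \<open>a ^ 7\<close> outgrows \<open>a ^ 4\<close>.\<close>

lemma clique_bound_tendsto_0:
  fixes p :: real
  assumes p: "0 < p" "p < 1"
  shows "(\<lambda>a. real ((2 ^ (a ^ 4) + 1) ^ (a ^ 8)) * p ^ (a ^ 8 choose 2)) \<longlonglongrightarrow> 0"
proof -
  define x where "x a = (2 ^ (a ^ 4) + 1) * p ^ (a ^ 7)" for a :: nat
  define c where "c = - ln p"
  have c: "0 < c" using p by (simp add: c_def)
  have x_eq: "x a = (exp (ln 2 * real a ^ 4) + 1) * exp (- c * real a ^ 7)" for a
  proof -
    have "exp (ln 2 * real a ^ 4) = (2::real) ^ (a ^ 4)"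
      by (rule exp_ln_power) simp
    moreover have "exp (- c * real a ^ 7) = p ^ (a ^ 7)"
      using exp_ln_power[OF p(1), of a 7] by (simp add: c_def)
    ultimately show ?thesis
      by (simp add: x_def)
  qed
  have lim: "x \<longlonglongrightarrow> 0"
    unfolding x_eq using c by real_asymp
  have ev: "eventually (\<lambda>a. norm (real ((2 ^ (a ^ 4) + 1) ^ (a ^ 8)) * p ^ (a ^ 8 choose 2)) \<le> x a) sequentially"
    using order_tendstoD(2)[OF lim zero_less_one] eventually_ge_at_top[of 3]
  proof eventually_elim
    case (elim a)
    define k where "k = a ^ 8"
    have x0: "0 \<le> x a"
      using p by (simp add: x_def)
    have k1: "k = a * a ^ 7"
      by (simp add: k_def flip: power_Suc)
    \<comment> \<open>One \<open>a ^ 7\<close> absorbs the 1 in \<open>k - 1\<close>; the other two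
      cancel the denominator of \<open>k choose 2\<close>.\<close>
    have "3 * a ^ 7 \<le> k"
      unfolding k1 using elim(2) by (rule mult_le_mono1)
    moreover have "1 \<le> a ^ 7"
      using elim(2) by (intro one_le_power) simp
    ultimately have "2 * a ^ 7 \<le> k - 1"
      by linarith
    then have "k * (2 * a ^ 7) \<le> k * (k - 1)"
      by (rule mult_le_mono2)
    then have "k * a ^ 7 \<le> k choose 2"
      unfolding choose_two by linarith
    then have "p ^ (k choose 2) \<le> p ^ (k * a ^ 7)"
      using p by (intro power_decreasing) auto
    then have "real ((2 ^ (a ^ 4) + 1) ^ k) * p ^ (k choose 2) \<le> (2 ^ (a ^ 4) + 1) ^ k * p ^ (k * a ^ 7)"
      by (simp add: mult_left_mono add.commute)
    also have "\<dots> = x a ^ k"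
      by (simp add: x_def power_mult_distrib mult.commute[of k] power_mult)
    also have "\<dots> \<le> x a ^ 1"
      using x0 elim by (intro power_decreasing) (auto simp: k_def)
    finally show ?case
      using p by (simp add: k_def)
  qed
  show ?thesis
    by (rule tendsto_0_le[OF lim, where K = 1], rule eventually_mono[OF ev]) auto
qed

text \<open>The exponent is about \<open>2 ^ (b ^ 3)\<close>, while
  \<open>\<mu> ^ (4 * b\<^sup>2)\<close> only costs a factor exponential in
  \<open>b\<^sup>2\<close>; the resulting doubly exponential decay beats the number of
  quadruples.\<close>

lemma separable_bound_tendsto_0:
  fixes \<mu> s v :: real
  assumes mu: "0 < \<mu>" "\<mu> < 1" and s: "0 < s" "s \<le> 1"
  shows "(\<lambda>b. real ((2 ^ (b ^ 3) + 1) ^ (2 * (4 * b\<^sup>2) + 2)) *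
    (v\<^sup>2 * (1 - \<mu> ^ (4 * b\<^sup>2) * s / 4) ^ (2 ^ (b ^ 3) - 4 * b\<^sup>2 - 2))) \<longlonglongrightarrow> 0"
proof -
  define c where "c = - ln \<mu>"
  have c: "0 < c" using mu by (simp add: c_def)
  define g where "g b = exp ((8 * real b ^ 2 + 2) * ln (exp (ln 2 * real b ^ 3) + 1)) *
    (v\<^sup>2 * exp (- (exp (- c * (4 * real b ^ 2)) * s / 4) * (exp (ln 2 * real b ^ 3) - 4 * real b ^ 2 - 2)))" for b :: nat
  have lim: "g \<longlonglongrightarrow> 0"
    unfolding g_def using c s by real_asymp
  have ev: "eventually (\<lambda>b. norm (real ((2 ^ (b ^ 3) + 1) ^ (2 * (4 * b\<^sup>2) + 2)) *
    (v\<^sup>2 * (1 - \<mu> ^ (4 * b\<^sup>2) * s / 4) ^ (2 ^ (b ^ 3) - 4 * b\<^sup>2 - 2))) \<le> g b) sequentially"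
  proof (intro always_eventually allI)
    fix b :: nat
    define y where "y = \<mu> ^ (4 * b\<^sup>2) * s / 4"
    have y: "0 \<le> y" "y \<le> 1"
      using mu s mult_le_one[of "\<mu> ^ (4 * b\<^sup>2)" s] by (auto simp: y_def power_le_one)
    have e2: "exp (ln 2 * real b ^ 3) = (2::real) ^ (b ^ 3)"
      by (rule exp_ln_power) simp
    have e\<mu>: "exp (- c * (4 * real b ^ 2)) = \<mu> ^ (4 * b\<^sup>2)"
    proof -
      have "- c * (4 * real b ^ 2) = real (4 * b\<^sup>2) * ln \<mu>"
        by (simp add: c_def)
      then show ?thesis
        using mu by (simp only: exp_of_nat_mult exp_ln)
    qed
    have "exp ((8 * real b ^ 2 + 2) * ln (exp (ln 2 * real b ^ 3) + 1)) = exp (real (2 * (4 * b\<^sup>2) + 2) * ln (2 ^ (b ^ 3) + 1))"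
      unfolding e2 by simp
    also have "\<dots> = (2 ^ (b ^ 3) + 1) ^ (2 * (4 * b\<^sup>2) + 2)"
      unfolding exp_of_nat_mult by (subst exp_ln) (auto intro: add_pos_pos)
    finally have e3: "exp ((8 * real b ^ 2 + 2) * ln (exp (ln 2 * real b ^ 3) + 1)) = real ((2 ^ (b ^ 3) + 1) ^ (2 * (4 * b\<^sup>2) + 2))"
      unfolding of_nat_power of_nat_add of_nat_numeral of_nat_1 .
    have "(1 - y) ^ (2 ^ (b ^ 3) - 4 * b\<^sup>2 - 2) \<le> exp (- y) ^ (2 ^ (b ^ 3) - 4 * b\<^sup>2 - 2)"
      using y exp_ge_add_one_self[of "- y"] by (intro power_mono) auto
    also have "\<dots> = exp (- y * real (2 ^ (b ^ 3) - 4 * b\<^sup>2 - 2))"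
      by (simp add: mult.commute flip: exp_of_nat_mult)
    also have "\<dots> \<le> exp (- y * (2 ^ (b ^ 3) - 4 * real b ^ 2 - 2))"
    proof -
      \<comment> \<open>The right side is a truncated difference of naturals, hence at least the
        real difference.\<close>
      have "(2::real) ^ (b ^ 3) - 4 * real b ^ 2 - 2 \<le> real (2 ^ (b ^ 3) - 4 * b\<^sup>2 - 2)"
      proof -
        have "int (2 ^ (b ^ 3)) - int (4 * b\<^sup>2) - 2 \<le> int (2 ^ (b ^ 3) - 4 * b\<^sup>2 - 2)"
          by linarith
        then have "real_of_int (int (2 ^ (b ^ 3)) - int (4 * b\<^sup>2) - 2) \<le> real_of_int (int (2 ^ (b ^ 3) - 4 * b\<^sup>2 - 2))"
          by (simp only: of_int_le_iff)
        then show ?thesis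
          by simp
      qed
      then show ?thesis
        using y by (simp add: mult_left_mono)
    qed
    finally have "(1 - y) ^ (2 ^ (b ^ 3) - 4 * b\<^sup>2 - 2) \<le> exp (- y * (2 ^ (b ^ 3) - 4 * real b ^ 2 - 2))" .
    then have "real ((2 ^ (b ^ 3) + 1) ^ (2 * (4 * b\<^sup>2) + 2)) * (v\<^sup>2 * (1 - y) ^ (2 ^ (b ^ 3) - 4 * b\<^sup>2 - 2)) \<le> g b"
      unfolding g_def e3 unfolding e2 e\<mu> y_def[symmetric] by (intro mult_left_mono) auto
    moreover have "0 \<le> real ((2 ^ (b ^ 3) + 1) ^ (2 * (4 * b\<^sup>2) + 2)) * (v\<^sup>2 * (1 - y) ^ (2 ^ (b ^ 3) - 4 * b\<^sup>2 - 2))"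
      using y by (intro mult_nonneg_nonneg) auto
    ultimately show "norm (real ((2 ^ (b ^ 3) + 1) ^ (2 * (4 * b\<^sup>2) + 2)) *
        (v\<^sup>2 * (1 - \<mu> ^ (4 * b\<^sup>2) * s / 4) ^ (2 ^ (b ^ 3) - 4 * b\<^sup>2 - 2))) \<le> g b"
      unfolding y_def[symmetric] by (simp only: real_norm_def abs_of_nonneg)
  qed
  show ?thesis
    by (rule tendsto_0_le[OF lim, where K = 1], rule eventually_mono[OF ev]) auto
qed

lemma prob_Gnp_bounds:
  assumes "0 < p" "p < 1"
  shows "0 \<le> prob_Gnp n p \<psi>" "prob_Gnp n p \<psi> \<le> 1"
proof -
  have "expct p (all_pairs n) (\<lambda>_. 0) \<le> prob_Gnp n p \<psi>"
    unfolding prob_Gnp_expct using assms by (intro expct_mono) auto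
  then show "0 \<le> prob_Gnp n p \<psi>"
    by (simp add: expct_def)
  have "prob_Gnp n p \<psi> \<le> expct p (all_pairs n) (\<lambda>_. 1)"
    unfolding prob_Gnp_expct using assms by (intro expct_mono) auto
  then show "prob_Gnp n p \<psi> \<le> 1"
    by (simp add: expct_1 finite_all_pairs)
qed

lemma prob_emso1_le_emso3:
  assumes "0 < p" "p < 1"
  shows "prob_Gnp n p emso1 \<le> prob_Gnp n p emso3"
  unfolding prob_Gnp_expct using assms emso1_imp_emso3 by (intro expct_mono) auto

lemma lsize_at_top: "filterlim (\<lambda>k. lsize (3 * k + r)) sequentially sequentially"
proof -
  have "k \<le> lsize (3 * k + r)" for k
  proof -
    have "k < 2 ^ k"
      by (rule less_exp)
    also have "\<dots> \<le> 2 ^ (3 * k + r)"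
      by (intro power_increasing) auto
    also have "\<dots> < lsize (3 * k + r)"
      by (rule less_exp)
    finally show ?thesis
      by simp
  qed
  then show ?thesis
    by (rule filterlim_at_top_mono[OF filterlim_ident always_eventually[OF allI]])
qed

lemma emso3_prob_tendsto_0:
  assumes p: "0 < p" "p < 1"
  shows "(\<lambda>k. prob_Gnp (2 ^ (lsize (3 * k + 3) ^ 4)) p emso3) \<longlonglongrightarrow> 0"
proof (rule tendsto_sandwich[OF _ _ tendsto_const])
  let ?B = "\<lambda>a. real ((2 ^ (a ^ 4) + 1) ^ (a ^ 8)) * p ^ (a ^ 8 choose 2)"
  show "(\<lambda>k. ?B (lsize (3 * k + 3))) \<longlonglongrightarrow> 0"
    by (rule filterlim_compose[OF clique_bound_tendsto_0[OF p] lsize_at_top])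
  show "\<forall>\<^sub>F k in sequentially. 0 \<le> prob_Gnp (2 ^ (lsize (3 * k + 3) ^ 4)) p emso3"
    using prob_Gnp_bounds[OF p] by simp
  show "\<forall>\<^sub>F k in sequentially. prob_Gnp (2 ^ (lsize (3 * k + 3) ^ 4)) p emso3 \<le> ?B (lsize (3 * k + 3))"
  proof (intro always_eventually allI)
    fix k
    define n where "n = (2::nat) ^ (lsize (3 * k + 3) ^ 4)"
    have "prob_Gnp n p emso3 \<le>
      expct p (all_pairs n) (\<lambda>E. of_bool (\<exists>K\<subseteq>{1..n}. card K = lsize (3 * k + 3) ^ 8 \<and> is_clique E K))"
      unfolding prob_Gnp_expct using p emso3_imp_clique[OF _ _ n_def] by (intro expct_mono) auto
    also have "\<dots> \<le> real ((n + 1) ^ (lsize (3 * k + 3) ^ 8)) * p ^ (lsize (3 * k + 3) ^ 8 choose 2)"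
      by (rule clique_prob[OF p])
    finally show "prob_Gnp (2 ^ (lsize (3 * k + 3) ^ 4)) p emso3 \<le> ?B (lsize (3 * k + 3))"
      unfolding n_def .
  qed
qed

text \<open>With \<open>b = lsize (j - 1)\<close>, the top level has \<open>b * b\<close> elements
  of each kind and all lower levels together have order \<open>j * b\<close>. From
  \<open>j = 4\<close> on, \<open>4 * j \<le> b\<close>, so the lower part is small enough for its
  codes to serve as indices \<open>p\<close>.\<close>

lemma lower_small:
  assumes "4 \<le> j"
  shows "card (lower j) \<le> lsize j" "card (hverts j) \<le> 4 * (lsize (j - 1))\<^sup>2"
proof -
  define b where "b = lsize (j - 1)"
  have bb: "lsize j = b * b"
    using lsize_Suc[of "j - 1"] assms by (simp add: b_def)
  have "j + 2 \<le> 2 ^ (j - 1)"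
    using assms
  proof (induction j rule: dec_induct)
    case (step j)
    then have "Suc j + 2 \<le> 2 * 2 ^ (j - 1)"
      by linarith
    also have "\<dots> = 2 ^ (Suc j - 1)"
      using step by (cases j) auto
    finally show ?case .
  qed simp
  then have "(2::nat) ^ (j + 2) \<le> b"
    unfolding b_def by (intro power_increasing) auto
  then have "4 * 2 ^ j \<le> b"
    by (simp add: power_add)
  then have jb: "4 * j \<le> b"
    using less_exp[of j] by linarith
  have b1: "16 \<le> b"
    using jb assms by linarith
  have "j + 1 \<le> 2 * j * b"
  proof -
    have "2 * j * 1 \<le> 2 * j * b"
      using b1 by (intro mult_le_mono2) simp
    then show ?thesis
      using assms by linarith
  qed
  then have "j + 1 + 2 * j * b \<le> (4 * j) * b"
    by linarith
  also have "\<dots> \<le> b * b"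
    using jb by (rule mult_le_mono1)
  finally have "j + 1 + 2 * j * b \<le> b * b" .
  then show *: "card (lower j) \<le> lsize j"
    unfolding bb using card_lower[of j] assms unfolding b_def by linarith
  have "16 * 16 \<le> b * b"
    using b1 by (intro mult_le_mono) auto
  then show "card (hverts j) \<le> 4 * (lsize (j - 1))\<^sup>2"
    using card_hverts[of j] * unfolding bb b_def[symmetric] power2_eq_square by linarith
qed

text \<open>The exponent \<open>b ^ 3\<close> of \<open>n\<close> lies between the order
  \<open>b\<^sup>2\<close> of the embedded tower, so that patterns on it are realised, and the
  number \<open>b ^ 4\<close> of separating vertices, so that all pairs get separated.\<close>

lemma emso1_prob_tendsto_1:
  assumes p: "0 < p" "p < 1"
  shows "(\<lambda>k. prob_Gnp (2 ^ (lsize (3 * k + 2) ^ 3)) p emso1) \<longlonglongrightarrow> 1"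
proof -
  define s where "s = 2 * p * (1 - p)"
  define v where "v = 1 + s / 4"
  have s: "0 < s" "s \<le> 1"
    unfolding s_def by (rule disagree_prob_bounds[OF p])+
  have v: "1 < v"
    using s by (simp add: v_def)
  let ?n = "\<lambda>b. (2::nat) ^ (b ^ 3)" and ?m = "\<lambda>b. 4 * b\<^sup>2 :: nat"
  let ?B = "\<lambda>b. real ((?n b + 1) ^ (2 * ?m b + 2)) * (v\<^sup>2 * (1 - min p (1 - p) ^ ?m b * s / 4) ^ (?n b - ?m b - 2))"
  have lim: "?B \<longlonglongrightarrow> 0"
    using p s by (intro separable_bound_tendsto_0) auto
  have ev1: "\<forall>\<^sub>F b in sequentially. ?m b + 2 \<le> ?n b"
  proof -
    have "\<forall>\<^sub>F b :: nat in sequentially. 4 * real b ^ 2 + 2 \<le> exp (ln 2 * real b ^ 3)"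
      by real_asymp
    then show ?thesis
    proof eventually_elim
      case (elim b)
      have "exp (ln 2 * real b ^ 3) = (2::real) ^ (b ^ 3)"
        by (rule exp_ln_power) simp
      with elim have "real (?m b + 2) \<le> real (?n b)"
        by simp
      then show ?case
        by (simp only: of_nat_le_iff)
    qed
  qed
  have ev2: "\<forall>\<^sub>F b in sequentially. (1 - sep_rate v) ^ (b ^ 4) * real (?n b) ^ 2 < 1"
  proof -
    define \<eta> where "\<eta> = 1 - sep_rate v"
    define c where "c = - ln \<eta>"
    have \<eta>: "0 < \<eta>" "\<eta> < 1"
      using sep_rate[OF v] by (auto simp: \<eta>_def)
    then have c: "0 < c"
      by (simp add: c_def)
    then have "\<forall>\<^sub>F b :: nat in sequentially. exp (- c * real b ^ 4) * exp (ln 2 * real b ^ 3) ^ 2 < 1"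
      by real_asymp
    then show ?thesis
    proof eventually_elim
      case (elim b)
      have "exp (ln 2 * real b ^ 3) = (2::real) ^ (b ^ 3)"
        by (rule exp_ln_power) simp
      moreover have "exp (- c * real b ^ 4) = \<eta> ^ (b ^ 4)"
        using exp_ln_power[OF \<eta>(1), of b 4] by (simp add: c_def)
      ultimately show ?case
        using elim by (simp add: \<eta>_def)
    qed
  qed
  show ?thesis
  proof (rule tendsto_sandwich[OF _ _ _ tendsto_const])
    have "(\<lambda>k. 1 - ?B (lsize (3 * k + 2))) \<longlonglongrightarrow> 1 - 0"
      by (intro tendsto_diff tendsto_const filterlim_compose[OF lim lsize_at_top])
    then show "(\<lambda>k. 1 - ?B (lsize (3 * k + 2))) \<longlonglongrightarrow> 1"
      by simp
    show "\<forall>\<^sub>F k in sequentially. prob_Gnp (?n (lsize (3 * k + 2))) p emso1 \<le> 1"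
      using prob_Gnp_bounds[OF p] by simp
    have "\<forall>\<^sub>F k in sequentially. ?m (lsize (3 * k + 2)) + 2 \<le> ?n (lsize (3 * k + 2)) \<and>
        (1 - sep_rate v) ^ (lsize (3 * k + 2) ^ 4) * real (?n (lsize (3 * k + 2))) ^ 2 < 1"
      using filterlim_iff[THEN iffD1, OF lsize_at_top, rule_format, OF eventually_conj[OF ev1 ev2]] .
    then show "\<forall>\<^sub>F k in sequentially. 1 - ?B (lsize (3 * k + 2)) \<le> prob_Gnp (?n (lsize (3 * k + 2))) p emso1"
      using eventually_ge_at_top[of 1]
    proof eventually_elim
      case (elim k)
      \<comment> \<open>The top index is one above that of \<open>b\<close>, so
        \<open>lsize j\<close> is the square of \<open>b\<close>; \<open>k \<ge> 1\<close> ensures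
        \<open>4 \<le> j\<close>.\<close>
      define j where "j = 3 * k + 3"
      define b where "b = lsize (3 * k + 2)"
      define n where "n = ?n b"
      have jb: "lsize (j - 1) = b" "lsize j * lsize j = b ^ 4"
        using lsize_Suc[of "3 * k + 2"] by (simp_all add: j_def b_def numeral_eq_Suc)
      have j: "3 dvd j" "0 < j" "4 \<le> j"
        using elim by (auto simp: j_def)
      have models: "emso_models n E emso1" if "E \<subseteq> all_pairs n" "separable n v (?m b) E" for E
      proof (rule separable_imp_emso1[OF that(2) v _ that(1) j(1,2)])
        show "?m b + 2 \<le> n"
          using elim unfolding n_def b_def by blast
        show "card (lower j) \<le> lsize j" "card (hverts j) \<le> ?m b"
          using lower_small[OF j(3)] unfolding jb by auto
        show "(1 - sep_rate v) ^ (lsize j * lsize j) * real n ^ 2 < 1"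
          using elim unfolding jb n_def b_def by blast
      qed
      have "1 = expct p (all_pairs n) (\<lambda>_. 1)"
        by (simp add: expct_1 finite_all_pairs)
      also have "\<dots> \<le> expct p (all_pairs n) (\<lambda>E. of_bool (emso_models n E emso1) + of_bool (\<not> separable n v (?m b) E))"
        using p models by (intro expct_mono) auto
      also have "\<dots> = prob_Gnp n p emso1 + expct p (all_pairs n) (\<lambda>E. of_bool (\<not> separable n v (?m b) E))"
        unfolding expct_add prob_Gnp_expct ..
      also have "\<dots> \<le> prob_Gnp n p emso1 + ?B b"
        using separable_prob[OF p, of n "?m b"] unfolding n_def v_def s_def by simp
      finally show ?case
        unfolding n_def b_def by linarith
    qed
  qed
qed

theorem theorem3:
  fixes p :: real
  assumes "0 < p" and "p < 1"
  shows "\<exists>\<phi>1 \<phi>2. emso_sentence \<phi>1 \<and> emso_num_fo_vars \<phi>1 \<le> 3 \<and>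
                  emso_sentence \<phi>2 \<and> emso_num_monadic \<phi>2 = 1 \<and>
                  \<not> convergent (\<lambda>n. prob_Gnp n p \<phi>1) \<and>
                  \<not> convergent (\<lambda>n. prob_Gnp n p \<phi>2)"
proof (rule exI[of _ emso3], rule exI[of _ emso1], intro conjI emso3_sentence emso1_sentence)
  have exp_at_top: "filterlim (\<lambda>k. (2::nat) ^ (lsize (3 * k + r) ^ e)) sequentially sequentially" if "0 < e" for r e
  proof -
    have "lsize (3 * k + r) \<le> 2 ^ (lsize (3 * k + r) ^ e)" for k
    proof -
      have "lsize (3 * k + r) ^ 1 \<le> lsize (3 * k + r) ^ e"
        using that by (intro power_increasing) auto
      also have "\<dots> \<le> 2 ^ (lsize (3 * k + r) ^ e)"
        by (rule less_imp_le[OF less_exp])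
      finally show ?thesis
        by simp
    qed
    then show ?thesis
      by (rule filterlim_at_top_mono[OF lsize_at_top always_eventually[OF allI]])
  qed
  have oscillates: "\<not> convergent (\<lambda>n. prob_Gnp n p \<phi>)"
    if "(\<lambda>k. prob_Gnp (2 ^ (lsize (3 * k + 3) ^ 4)) p \<phi>) \<longlonglongrightarrow> 0"
       "(\<lambda>k. prob_Gnp (2 ^ (lsize (3 * k + 2) ^ 3)) p \<phi>) \<longlonglongrightarrow> 1" for \<phi>
  proof
    assume "convergent (\<lambda>n. prob_Gnp n p \<phi>)"
    then obtain L where L: "(\<lambda>n. prob_Gnp n p \<phi>) \<longlonglongrightarrow> L"
      by (auto simp: convergent_def)
    have "L = 0"
      using LIMSEQ_unique[OF filterlim_compose[OF L exp_at_top[of 4 3]] that(1)] by simp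
    moreover have "L = 1"
      using LIMSEQ_unique[OF filterlim_compose[OF L exp_at_top[of 3 2]] that(2)] by simp
    ultimately show False
      by simp
  qed
  \<comment> \<open>The comparison transfers the limit 1 from \<open>emso1\<close> up to
    \<open>emso3\<close> and the limit 0 from \<open>emso3\<close> down to
    \<open>emso1\<close>.\<close>
  note le = prob_emso1_le_emso3[OF assms] and bounds = prob_Gnp_bounds[OF assms]
  have "(\<lambda>k. prob_Gnp (2 ^ (lsize (3 * k + 2) ^ 3)) p emso3) \<longlonglongrightarrow> 1"
    by (rule tendsto_sandwich[OF _ _ emso1_prob_tendsto_1[OF assms] tendsto_const]) (simp_all add: le bounds)
  then show "\<not> convergent (\<lambda>n. prob_Gnp n p emso3)"
    by (rule oscillates[OF emso3_prob_tendsto_0[OF assms]])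
  have "(\<lambda>k. prob_Gnp (2 ^ (lsize (3 * k + 3) ^ 4)) p emso1) \<longlonglongrightarrow> 0"
    by (rule tendsto_sandwich[OF _ _ tendsto_const emso3_prob_tendsto_0[OF assms]]) (simp_all add: le bounds)
  then show "\<not> convergent (\<lambda>n. prob_Gnp n p emso1)"
    by (rule oscillates[OF _ emso1_prob_tendsto_1[OF assms]])
qed

end
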